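(* Let $r>0$, let $s\ge2$ be an integer, and let $a>1/2$. Then there is a number $N^*(a,s)$ such that for every integer $N\ge N^*(a,s)$, $$2^{-1}\left(\bigl[N(s-1)!(s+2)\bigr]^{-1}\left[\ln\frac{N(s-1)!}{a^s}\right]^{s-1}\right)^r\ \le\ d_N\bigl(U^{r,a}(\mathbb I^s,w),L_2(\mathbb I^s,w)\bigr)\ \le\ 2^r\left(\bigl[N(s-1)!\bigr]^{-1}\left[\ln\frac{N(s-1)!}{(a-1/2)^s}\right]^{s-1}\right)^r.$$
   Context: $\mathbb N_0=\{0,1,2,\dots\}$, $\mathbb I^s=[-1,1]^s$. Fix $\alpha,\beta>-1$ and let $a:=(\alpha+\beta+1)/2$, assumed positive. $L_2(\mathbb I^s,w)$ is the Hilbert space with inner product $(f,g)_w=\int_{\mathbb I^s}f(\mathbf x)g(\mathbf x)w(\mathbf x)\,d\mathbf x$, where $w(\mathbf x)=\prod_{j=1}^s(1-x_j)^\alpha(1+x_j)^\beta$. $\{P^{(\alpha,\beta)}_k\}_{k\ge0}$ are the orthonormal Jacobi polynomials on $[-1,1]$ for the weight $(1-x)^\alpha(1+x)^\beta$; $P^{(\alpha,\beta)}_{\mathbf k}(\mathbf x)=\prod_{j=1}^sP^{(\alpha,\beta)}_{k_j}(x_j)$ for $\mathbf k\in\mathbb N_0^s$, and $f_{\mathbf k}=(f,P^{(\alpha,\beta)}_{\mathbf k})_w$. With $\lambda_a(\mathbf k):=\prod_{j=1}^s(a+k_j)$, $K^{r,a}(\mathbb I^s,w)$ is the space of $f\in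 L_2(\mathbb I^s,w)$ with finite norm $\|f\|_{K^{r,a}(\mathbb I^s,w)}=\bigl(\sum_{\mathbf k\in\mathbb N_0^s}\lambda_a(\mathbf k)^{2r}|f_{\mathbf k}|^2\bigr)^{1/2}$, and $U^{r,a}(\mathbb I^s,w)$ is its (closed) unit ball. For a normed space $X$ and a centrally symmetric $W\subset X$, the Kolmogorov $N$-width is $d_N(W,X):=\inf_{L_N}\sup_{f\in W}\inf_{g\in L_N}\|f-g\|_X$, the outer infimum over all linear subspaces $L_N\subset X$ of dimension $\le N$. *)

theory Defs
  imports
    "HOL-Analysis.Analysis"
    "HOL-Computational_Algebra.Polynomial"
    "HOL-Library.Function_Algebras"
begin

instantiation "fun" :: (type, real_vector) real_vector
begin

definition scaleR_fun :: "real \<Rightarrow> ('a \<Rightarrow> 'b) \<Rightarrow> 'a \<Rightarrow> 'b"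
  where "scaleR_fun c f = (\<lambda>x. c *\<^sub>R f x)"

instance
  by standard (simp_all add: scaleR_fun_def fun_eq_iff scaleR_add_right scaleR_add_left)

end

lemma scaleR_fun_apply [simp]: "(c *\<^sub>R f) x = c *\<^sub>R f x"
  by (simp add: scaleR_fun_def)


section \<open>Kolmogorov widths\<close>

text \<open>
  The space \<open>X\<close> is given by a carrier and a (semi)norm.  For \<open>X = L\<^sub>2\<close> the carrier consists of
  functions rather than of classes modulo equality almost everywhere, and the norm is the
  corresponding seminorm.  This does not change the width: a span of at most \<open>N\<close> functions induces
  a subspace of dimension at most \<open>N\<close> of the quotient, every such subspace arises in this way, and
  the distances are the same.  The width is an extended real, so that the infima and suprema need
  no side conditions.
\<close>

definition kolmogorov_width ::
    "nat \<Rightarrow> 'v::real_vector set \<Rightarrow> 'v set \<Rightarrow> ('v \<Rightarrow> real) \<Rightarrow> ereal" where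
  "kolmogorov_width N W X nrm =
     (INF L \<in> {L. subspace L \<and> L \<subseteq> X \<and> (\<exists>B. finite B \<and> card B \<le> N \<and> L = span B)}.
        SUP f \<in> W. INF g \<in> L. ereal (nrm (f - g)))"


section \<open>Weighted inner products\<close>

definition weighted_inner ::
    "'a::euclidean_space set \<Rightarrow> ('a \<Rightarrow> real) \<Rightarrow> ('a \<Rightarrow> real) \<Rightarrow> ('a \<Rightarrow> real) \<Rightarrow> real" where
  "weighted_inner S w f g = (LINT x|lebesgue_on S. f x * g x * w x)"

definition jacobi_weight :: "real \<Rightarrow> real \<Rightarrow> real \<Rightarrow> real" where
  "jacobi_weight \<alpha> \<beta> x = (1 - x) powr \<alpha> * (1 + x) powr \<beta>"

abbreviation jacobi_inner :: "real \<Rightarrow> real \<Rightarrow> (real \<Rightarrow> real) \<Rightarrow> (real \<Rightarrow> real) \<Rightarrow> real" where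
  "jacobi_inner \<alpha> \<beta> \<equiv> weighted_inner {-1..1} (jacobi_weight \<alpha> \<beta>)"


section \<open>Orthonormal Jacobi polynomials\<close>

text \<open>
  Gram--Schmidt applied to \<open>1, x, x\<^sup>2, \<dots>\<close>; the sign is fixed by a positive leading
  coefficient.  The defining properties are \<open>degree_jacobi_poly\<close>, \<open>lead_coeff_jacobi_poly\<close>
  and \<open>orthonormal_jacobi\<close> below.
\<close>

fun jacobi_poly :: "real \<Rightarrow> real \<Rightarrow> nat \<Rightarrow> real poly" where
  "jacobi_poly \<alpha> \<beta> n =
     (let q = monom 1 n - (\<Sum>k<n. smult (jacobi_inner \<alpha> \<beta> (poly (monom 1 n)) (poly (jacobi_poly \<alpha> \<beta> k)))
                                       (jacobi_poly \<alpha> \<beta> k))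
      in smult (1 / sqrt (jacobi_inner \<alpha> \<beta> (poly q) (poly q))) q)"

declare jacobi_poly.simps [simp del]

lemma integrable_jacobi_weight:
  assumes "\<alpha> > -1" "\<beta> > -1"
  shows "integrable (lebesgue_on {-1..1}) (jacobi_weight \<alpha> \<beta>)"
proof -
  let ?g = "\<lambda>t::real. t powr \<beta> * (1 - t) powr \<alpha>"
  have "(?g has_integral Beta (\<beta> + 1) (\<alpha> + 1)) (cbox 0 1)"
    using has_integral_Beta_real[of "\<beta> + 1" "\<alpha> + 1"] assms by simp
  from has_integral_affinity'[OF this, of "1/2" "1/2"]
  have "(\<lambda>x. ?g (1/2 * x + 1/2)) integrable_on {-1..1}"
    by (auto simp: integrable_on_def)
  hence "(\<lambda>x. 2 powr (\<alpha> + \<beta>) * ?g (1/2 * x + 1/2)) integrable_on {-1..1}"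
    by (rule integrable_on_mult_right)
  moreover have "2 powr (\<alpha> + \<beta>) * ?g (1/2 * x + 1/2) = jacobi_weight \<alpha> \<beta> x"
    if "x \<in> {-1..1}" for x :: real
  proof -
    have "1 - (1/2 * x + 1/2) = (1 - x) / 2" "1/2 * x + 1/2 = (1 + x) / 2"
      by (simp_all add: field_simps)
    then have "?g (1/2 * x + 1/2) = ((1 + x) / 2) powr \<beta> * ((1 - x) / 2) powr \<alpha>"
      by (simp only:)
    then show ?thesis
      using that unfolding jacobi_weight_def by (simp only: powr_add) (simp add: powr_divide)
  qed
  ultimately have "jacobi_weight \<alpha> \<beta> integrable_on {-1..1}"
    by (rule integrable_eq)
  hence "jacobi_weight \<alpha> \<beta> absolutely_integrable_on {-1..1}"
    by (rule nonnegative_absolutely_integrable_1) (simp add: jacobi_weight_def)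
  then show ?thesis
    by (simp add: set_integrable_def integrable_restrict_space)
qed

lemma integrable_poly_jacobi_weight:
  assumes "\<alpha> > -1" "\<beta> > -1"
  shows "integrable (lebesgue_on {-1..1}) (\<lambda>x. poly p x * jacobi_weight \<alpha> \<beta> x)"
proof -
  have "bounded (poly p ` {-1..1})"
    by (intro compact_imp_bounded compact_continuous_image continuous_intros) auto
  then obtain C where C: "\<And>x. x \<in> {-1..1} \<Longrightarrow> \<bar>poly p x\<bar> \<le> C"
    unfolding bounded_iff by (metis imageI real_norm_def)
  have meas: "poly p \<in> borel_measurable (lebesgue_on {-1..1})"
    by (intro continuous_imp_measurable_on_sets_lebesgue continuous_intros) auto
  have "integrable (lebesgue_on {-1..1}) (\<lambda>x. C * jacobi_weight \<alpha> \<beta> x)"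
    using integrable_jacobi_weight[OF assms] by simp
  then show ?thesis
  proof (rule Bochner_Integration.integrable_bound)
    show "(\<lambda>x. poly p x * jacobi_weight \<alpha> \<beta> x) \<in> borel_measurable (lebesgue_on {-1..1})"
      using meas integrable_jacobi_weight[OF assms] by (intro borel_measurable_times) auto
    show "AE x in lebesgue_on {-1..1}.
        norm (poly p x * jacobi_weight \<alpha> \<beta> x) \<le> norm (C * jacobi_weight \<alpha> \<beta> x)"
    proof (rule AE_I2)
      fix x :: real assume "x \<in> space (lebesgue_on {-1..1})"
      hence "\<bar>poly p x\<bar> \<le> \<bar>C\<bar>" using C[of x] by simp
      then show "norm (poly p x * jacobi_weight \<alpha> \<beta> x) \<le> norm (C * jacobi_weight \<alpha> \<beta> x)"
        by (simp add: abs_mult mult_right_mono)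
    qed
  qed
qed

lemma jacobi_inner_commute: "jacobi_inner \<alpha> \<beta> f g = jacobi_inner \<alpha> \<beta> g f"
  by (simp add: weighted_inner_def mult.commute)

context
  fixes \<alpha> \<beta> :: real
  assumes ab: "\<alpha> > -1" "\<beta> > -1"
begin

private lemma int2:
  "integrable (lebesgue_on {-1..1}) (\<lambda>x. poly p x * poly q x * jacobi_weight \<alpha> \<beta> x)"
  using integrable_poly_jacobi_weight[OF ab, of "p * q"] by simp

lemma jacobi_inner_diff:
  "jacobi_inner \<alpha> \<beta> (poly (p - q)) (poly r) =
     jacobi_inner \<alpha> \<beta> (poly p) (poly r) - jacobi_inner \<alpha> \<beta> (poly q) (poly r)"
  using int2 by (simp add: weighted_inner_def left_diff_distrib)

lemma jacobi_inner_smult: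
  "jacobi_inner \<alpha> \<beta> (poly (smult c p)) (poly r) = c * jacobi_inner \<alpha> \<beta> (poly p) (poly r)"
  by (simp add: weighted_inner_def mult.assoc)

lemma jacobi_inner_sum:
  "finite A \<Longrightarrow> jacobi_inner \<alpha> \<beta> (poly (\<Sum>k\<in>A. p k)) (poly r) =
     (\<Sum>k\<in>A. jacobi_inner \<alpha> \<beta> (poly (p k)) (poly r))"
  using int2 by (simp add: weighted_inner_def poly_sum sum_distrib_right)

lemma jacobi_inner_pos:
  assumes "p \<noteq> 0"
  shows "jacobi_inner \<alpha> \<beta> (poly p) (poly p) > 0"
proof -
  let ?f = "\<lambda>x. poly p x * poly p x * jacobi_weight \<alpha> \<beta> x"
  have nn: "AE x in lebesgue_on {-1..1}. 0 \<le> ?f x"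
    by (simp add: jacobi_weight_def)
  hence ge: "jacobi_inner \<alpha> \<beta> (poly p) (poly p) \<ge> 0"
    unfolding weighted_inner_def by (rule integral_nonneg_AE)
  have "jacobi_inner \<alpha> \<beta> (poly p) (poly p) \<noteq> 0"
  proof
    assume "jacobi_inner \<alpha> \<beta> (poly p) (poly p) = 0"
    hence "AE x in lebesgue_on {-1..1}. ?f x = 0"
      using integral_nonneg_eq_0_iff_AE[OF int2 nn] by (simp add: weighted_inner_def)
    hence "AE x in lebesgue. x \<in> {-1..1} \<longrightarrow> ?f x = 0"
      by (subst (asm) AE_restrict_space_iff) auto
    hence "negligible {x. \<not> (x \<in> {-1..1} \<longrightarrow> ?f x = 0)}"
      by (simp only: negligible_iff_null_sets eventually_ae_filter_negligible)
         (metis (mono_tags, lifting) negligible_iff_null_sets negligible_subset)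
    moreover have "negligible {x. poly p x = 0}"
      using poly_roots_finite[OF assms] by (rule negligible_finite)
    ultimately have "negligible ({x. \<not> (x \<in> {-1..1} \<longrightarrow> ?f x = 0)} \<union> {x. poly p x = 0})"
      by (rule negligible_Un)
    moreover have "{-1<..<1} \<subseteq> {x. \<not> (x \<in> {-1..1} \<longrightarrow> ?f x = 0)} \<union> {x. poly p x = 0}"
      by (auto simp: jacobi_weight_def)
    ultimately have "negligible {-1<..<1::real}"
      by (rule negligible_subset)
    then show False
      using open_not_negligible[of "{-1<..<1::real}"] by simp
  qed
  with ge show ?thesis by simp
qed

private definition gs :: "nat \<Rightarrow> real poly" where
  "gs n = monom 1 n -
     (\<Sum>k<n. smult (jacobi_inner \<alpha> \<beta> (poly (monom 1 n)) (poly (jacobi_poly \<alpha> \<beta> k)))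
                   (jacobi_poly \<alpha> \<beta> k))"

private lemma jacobi_eq_gs:
  "jacobi_poly \<alpha> \<beta> n = smult (1 / sqrt (jacobi_inner \<alpha> \<beta> (poly (gs n)) (poly (gs n)))) (gs n)"
  by (subst jacobi_poly.simps) (simp add: Let_def gs_def)

private lemma gs_degree:
  assumes "\<And>k. k < n \<Longrightarrow> degree (jacobi_poly \<alpha> \<beta> k) = k"
  shows "degree (gs n) = n" "lead_coeff (gs n) = 1" "gs n \<noteq> 0"
proof -
  let ?S = "\<Sum>k<n. smult (jacobi_inner \<alpha> \<beta> (poly (monom 1 n)) (poly (jacobi_poly \<alpha> \<beta> k)))
                   (jacobi_poly \<alpha> \<beta> k)"
  have c: "coeff ?S m = 0" if "m \<ge> n" for m
    using that assms by (auto simp: coeff_sum coeff_eq_0 intro!: sum.neutral)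
  have "coeff (gs n) n = 1" "\<And>m. m > n \<Longrightarrow> coeff (gs n) m = 0"
    using c by (auto simp: gs_def)
  then show "degree (gs n) = n" "lead_coeff (gs n) = 1" "gs n \<noteq> 0"
    by (metis degree_le le_antisym le_degree zero_neq_one)
       (metis \<open>coeff (gs n) n = 1\<close> \<open>\<And>m. m > n \<Longrightarrow> coeff (gs n) m = 0\<close> degree_le le_antisym le_degree zero_neq_one,
        use \<open>coeff (gs n) n = 1\<close> in auto)
qed

lemma degree_jacobi_poly: "degree (jacobi_poly \<alpha> \<beta> n) = n"
proof (induction n rule: less_induct)
  case (less n)
  note gs = gs_degree[OF less.IH]
  have "jacobi_inner \<alpha> \<beta> (poly (gs n)) (poly (gs n)) > 0"
    by (intro jacobi_inner_pos gs(3)) auto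
  then show ?case
    using gs(1) by (subst jacobi_eq_gs) simp
qed

private lemmas gs' = gs_degree[OF degree_jacobi_poly]

lemma lead_coeff_jacobi_poly: "lead_coeff (jacobi_poly \<alpha> \<beta> n) > 0"
  using jacobi_inner_pos[OF gs'(3)[of n]] gs'(2)[of n]
  by (simp only: jacobi_eq_gs[of n] lead_coeff_smult) simp

theorem orthonormal_jacobi:
  "jacobi_inner \<alpha> \<beta> (poly (jacobi_poly \<alpha> \<beta> m)) (poly (jacobi_poly \<alpha> \<beta> n)) = (if m = n then 1 else 0)"
proof -
  have norm: "jacobi_inner \<alpha> \<beta> (poly (jacobi_poly \<alpha> \<beta> n)) (poly (jacobi_poly \<alpha> \<beta> n)) = 1" for n
  proof -
    let ?I = "jacobi_inner \<alpha> \<beta> (poly (gs n)) (poly (gs n))"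
    have pos: "?I > 0" by (intro jacobi_inner_pos gs'(3))
    have "jacobi_inner \<alpha> \<beta> (poly (smult c (gs n))) (poly (smult c (gs n))) = c * (c * ?I)" for c
      by (metis jacobi_inner_smult jacobi_inner_commute)
    then show ?thesis
      using pos by (simp add: jacobi_eq_gs[of n] field_simps del: poly_smult)
  qed
  have orth: "jacobi_inner \<alpha> \<beta> (poly (jacobi_poly \<alpha> \<beta> n)) (poly (jacobi_poly \<alpha> \<beta> m)) = 0"
    if "m < n" for m n
    using that
  proof (induction n arbitrary: m rule: less_induct)
    case (less n)
    have o: "jacobi_inner \<alpha> \<beta> (poly (jacobi_poly \<alpha> \<beta> k)) (poly (jacobi_poly \<alpha> \<beta> m)) =
        (if k = m then 1 else 0)" if "k < n" for k
      using less.IH[of k m] less.IH[of m k] less.prems that norm[of m]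
      by (metis jacobi_inner_commute linorder_neqE_nat)
    have "jacobi_inner \<alpha> \<beta> (poly (gs n)) (poly (jacobi_poly \<alpha> \<beta> m)) = 0"
      using less.prems
      by (simp add: gs_def jacobi_inner_diff jacobi_inner_sum jacobi_inner_smult o del: poly_diff poly_smult)
         (simp add: o sum.delta' if_distrib cong: if_cong sum.cong)
    then show ?case
      by (subst jacobi_eq_gs) (simp only: jacobi_inner_smult mult_zero_right)
  qed
  show ?thesis
    using norm orth[of m n] orth[of n m] by (metis jacobi_inner_commute linorder_neqE_nat)
qed

end


section \<open>The spaces \<open>L\<^sub>2(I\<^sup>s, w)\<close> and \<open>K\<^sup>r\<^sup>,\<^sup>a(I\<^sup>s, w)\<close>\<close>

text \<open>The dimension is \<open>s = CARD('s)\<close>.\<close>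

definition cube :: "(real ^ 's) set" where
  "cube = {x. \<forall>j. x $ j \<in> {-1..1}}"

definition cube_weight :: "real \<Rightarrow> real \<Rightarrow> real ^ 's \<Rightarrow> real" where
  "cube_weight \<alpha> \<beta> x = (\<Prod>j\<in>UNIV. (1 - x $ j) powr \<alpha> * (1 + x $ j) powr \<beta>)"

text \<open>Values outside the cube are arbitrary; they do not enter the inner product.\<close>

definition L2 :: "real \<Rightarrow> real \<Rightarrow> (real ^ 's \<Rightarrow> real) set" where
  "L2 \<alpha> \<beta> = {f. f \<in> borel_measurable (lebesgue_on cube) \<and>
                 integrable (lebesgue_on cube) (\<lambda>x. (f x)\<^sup>2 * cube_weight \<alpha> \<beta> x)}"

definition L2_inner :: "real \<Rightarrow> real \<Rightarrow> (real ^ 's \<Rightarrow> real) \<Rightarrow> (real ^ 's \<Rightarrow> real) \<Rightarrow> real" where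
  "L2_inner \<alpha> \<beta> = weighted_inner cube (cube_weight \<alpha> \<beta>)"

definition L2_norm :: "real \<Rightarrow> real \<Rightarrow> (real ^ 's \<Rightarrow> real) \<Rightarrow> real" where
  "L2_norm \<alpha> \<beta> f = sqrt (L2_inner \<alpha> \<beta> f f)"

definition jacobi_tensor :: "real \<Rightarrow> real \<Rightarrow> nat ^ 's \<Rightarrow> real ^ 's \<Rightarrow> real" where
  "jacobi_tensor \<alpha> \<beta> k x = (\<Prod>j\<in>UNIV. poly (jacobi_poly \<alpha> \<beta> (k $ j)) (x $ j))"

definition jacobi_coeff :: "real \<Rightarrow> real \<Rightarrow> (real ^ 's \<Rightarrow> real) \<Rightarrow> nat ^ 's \<Rightarrow> real" where
  "jacobi_coeff \<alpha> \<beta> f k = L2_inner \<alpha> \<beta> f (jacobi_tensor \<alpha> \<beta> k)"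

definition lam :: "real \<Rightarrow> nat ^ 's \<Rightarrow> real" where
  "lam a k = (\<Prod>j\<in>UNIV. a + real (k $ j))"

definition K_space :: "real \<Rightarrow> real \<Rightarrow> real \<Rightarrow> real \<Rightarrow> (real ^ 's \<Rightarrow> real) set" where
  "K_space r a \<alpha> \<beta> =
     {f \<in> L2 \<alpha> \<beta>. (\<lambda>k. lam a k powr (2 * r) * \<bar>jacobi_coeff \<alpha> \<beta> f k\<bar>\<^sup>2) summable_on UNIV}"

definition K_norm :: "real \<Rightarrow> real \<Rightarrow> real \<Rightarrow> real \<Rightarrow> (real ^ 's \<Rightarrow> real) \<Rightarrow> real" where
  "K_norm r a \<alpha> \<beta> f = sqrt (\<Sum>\<^sub>\<infinity>k. lam a k powr (2 * r) * \<bar>jacobi_coeff \<alpha> \<beta> f k\<bar>\<^sup>2)"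

definition K_ball :: "real \<Rightarrow> real \<Rightarrow> real \<Rightarrow> real \<Rightarrow> (real ^ 's \<Rightarrow> real) set" where
  "K_ball r a \<alpha> \<beta> = {f \<in> K_space r a \<alpha> \<beta>. K_norm r a \<alpha> \<beta> f \<le> 1}"

end

(* The tensor Jacobi polynomials form a complete orthonormal system, so U^{r,a} is an ellipsoid with
   semi-axes lambda_a(k)^{-r}, and its N-width is the (N+1)-st largest semi-axis: it is at most
   T^{-r} if the hyperbolic cross {k. lambda_a(k) <= T} has at most N points, and at least T^{-r} if
   it has more than N.  Both bounds thus amount to counting the points of a hyperbolic cross.
   Slicing along one coordinate and telescoping differences of powers of logarithms gives, by
   induction on s, upper and lower bounds M T (ln T)^{s-1} / (s-1)! up to lower-order terms, with
   constants M = max 1 (1/a) < 2 and M = 1/2.  These suffice, because the theorem leaves a factor 2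
   above and s + 2 > 2 below. *)

theory Submission
  imports Defs
begin

section \<open>Kolmogorov widths and orthonormal systems\<close>

text \<open>The lower-order terms of the counting bounds decide the asymptotics, so they are kept
  explicit inside the power of the logarithm. Write n = s - 1, let L be the logarithm in the
  respective bound of the theorem, and take T of order N n! / L^n. Then ln T = L - n ln L + O(1). In
  the upper bound the term - n ln L works in the right direction: as n \<ge> 1, it swallows every
  constant once L is large. In the lower bound it is a loss, but (ln T + O(1)) / L still tends to 1,
  and the surplus of (s + 2) / 2 over 1 pays for it. The obstacle in the induction on the dimension
  is the range of validity: a slice with small parameter is empty, while the formula for it would be
  a power of a negative number. Truncating the bases at 0 makes the telescoping sums run through all
  slices. On the side of the widths, elements of \<open>L2\<close> are functions, so the inner
  product is only semidefinite. Density of finite combinations together with bounds on finite sums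
  of squared coefficients takes the place of Parseval's identity.\<close>

lemma underdetermined_system:
  fixes A :: "'k \<Rightarrow> 'b \<Rightarrow> real"
  assumes "finite B" "finite G" "card B < card G"
  shows "\<exists>c. (\<exists>k\<in>G. c k \<noteq> 0) \<and> (\<forall>b\<in>B. (\<Sum>k\<in>G. c k * A k b) = 0)"
  using assms
proof (induction B arbitrary: A G rule: finite_induct)
  case empty
  then obtain k where "k \<in> G" by (metis all_not_in_conv card.empty less_irrefl)
  then show ?case by (intro exI[of _ "\<lambda>_. 1"]) auto
next
  case (insert b B)
  show ?case
  proof (cases "\<forall>k\<in>G. A k b = 0")
    case True
    then show ?thesis using insert.IH[of G A] insert.prems insert.hyps by auto
  next
    case False
    then obtain p where p: "p \<in> G" "A p b \<noteq> 0" by auto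
    define G' where "G' = G - {p}"
    \<comment> \<open>Gaussian elimination: equation \<open>b\<close> is solved for the unknown
      \<open>p\<close>, and \<open>A'\<close> is the system that remains for the other unknowns. Its
      row \<open>b\<close> is zero.\<close>
    define A' where "A' k b' = A k b' - A k b / A p b * A p b'" for k b'
    have G': "G = insert p G'" "p \<notin> G'" "finite G'" using p insert.prems by (auto simp: G'_def)
    have "card B < card G'" using G' insert.prems insert.hyps by simp
    from insert.IH[OF G'(3) this, of A'] obtain c where
      c: "\<exists>k\<in>G'. c k \<noteq> 0" "\<And>b'. b' \<in> B \<Longrightarrow> (\<Sum>k\<in>G'. c k * A' k b') = 0" by blast
    define d where "d = c(p := - (\<Sum>k\<in>G'. c k * (A k b / A p b)))"
    have sum: "(\<Sum>k\<in>G. d k * A k b') = (\<Sum>k\<in>G'. c k * A' k b')" for b'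
    proof -
      have "(\<Sum>k\<in>G. d k * A k b') = d p * A p b' + (\<Sum>k\<in>G'. d k * A k b')"
        using G' by simp
      also have "(\<Sum>k\<in>G'. d k * A k b') = (\<Sum>k\<in>G'. c k * A k b')"
        using G'(2) by (intro sum.cong) (auto simp: d_def)
      also have "d p * A p b' = - (\<Sum>k\<in>G'. c k * (A k b / A p b) * A p b')"
        by (simp add: d_def sum_distrib_right)
      finally show ?thesis by (simp add: A'_def algebra_simps sum_subtractf)
    qed
    have "\<exists>k\<in>G. d k \<noteq> 0" using c(1) G' by (auto simp: d_def)
    moreover have "(\<Sum>k\<in>G. d k * A k b') = 0" if "b' \<in> insert b B" for b'
    proof (cases "b' = b")
      case True
      then show ?thesis using p(2) unfolding sum by (simp add: A'_def)
    next
      case False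
      then show ?thesis using that c(2) unfolding sum by blast
    qed
    ultimately show ?thesis by blast
  qed
qed

text \<open>The laws are required only on the carrier, since the integrals behind
  \<open>L2_inner\<close> are additive only for square-integrable functions. Definiteness is not
  demanded, since a function vanishing almost everywhere has norm 0.\<close>

locale semi_inner_product =
  fixes X :: "'v::real_vector set" and ip :: "'v \<Rightarrow> 'v \<Rightarrow> real"
  assumes subspace_carrier: "subspace X"
    and ip_commute: "\<lbrakk>f \<in> X; g \<in> X\<rbrakk> \<Longrightarrow> ip f g = ip g f"
    and ip_add_left: "\<lbrakk>f \<in> X; g \<in> X; h \<in> X\<rbrakk> \<Longrightarrow> ip (f + g) h = ip f h + ip g h"
    and ip_scaleR_left: "\<lbrakk>f \<in> X; h \<in> X\<rbrakk> \<Longrightarrow> ip (c *\<^sub>R f) h = c * ip f h"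
    and ip_nonneg: "f \<in> X \<Longrightarrow> 0 \<le> ip f f"
begin

lemmas carrier_add = subspace_add[OF subspace_carrier]
  and carrier_diff = subspace_diff[OF subspace_carrier]
  and carrier_scaleR = subspace_scale[OF subspace_carrier]
  and carrier_sum = subspace_sum[OF subspace_carrier]

lemma ip_diff_left:
  assumes "f \<in> X" "g \<in> X" "h \<in> X"
  shows "ip (f - g) h = ip f h - ip g h"
  using ip_add_left[of "f - g" g h] carrier_diff assms by simp

lemma ip_zero_left: "h \<in> X \<Longrightarrow> ip 0 h = 0"
  using ip_scaleR_left[of h h 0] by simp

lemma ip_sum_left:
  assumes "\<And>k. k \<in> F \<Longrightarrow> u k \<in> X" "h \<in> X"
  shows "ip (sum u F) h = (\<Sum>k\<in>F. ip (u k) h)"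
  using assms
proof (induction F rule: infinite_finite_induct)
  case (insert k F)
  then show ?case by (simp add: ip_add_left carrier_sum)
qed (auto simp: ip_zero_left)

lemma ip_diff_diff:
  assumes "f \<in> X" "g \<in> X"
  shows "ip (f - g) (f - g) = ip f f - 2 * ip f g + ip g g"
  using assms ip_commute[of f "f - g"] ip_commute[of g "f - g"] ip_commute[of f g]
  by (simp add: ip_diff_left carrier_diff)

text \<open>Follows from \<open>0 \<le> ip (f - g) (f - g)\<close>; it plays the part of the
  triangle inequality when approximations are chained in terms of squared norms.\<close>

lemma ip_add_add_le:
  assumes "f \<in> X" "g \<in> X"
  shows "ip (f + g) (f + g) \<le> 2 * ip f f + 2 * ip g g"
proof -
  have "ip (f + g) (f + g) = ip f f + 2 * ip f g + ip g g"
    using assms ip_commute[of f "f + g"] ip_commute[of g "f + g"] ip_commute[of f g]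
    by (simp add: ip_add_left carrier_add)
  moreover have "0 \<le> ip f f - 2 * ip f g + ip g g"
    using ip_nonneg[OF carrier_diff[OF assms]] ip_diff_diff[OF assms] by simp
  ultimately show ?thesis by simp
qed

end

section \<open>Orthonormal expansions and width bounds\<close>

locale orthonormal_family = semi_inner_product X ip
  for X :: "'v::real_vector set" and ip +
  fixes e :: "'k \<Rightarrow> 'v"
  assumes basis_mem: "e k \<in> X"
    and ip_basis: "ip (e j) (e k) = (if j = k then 1 else 0)"
begin

lemma comb_mem: "(\<Sum>k\<in>F. c k *\<^sub>R e k) \<in> X"
  by (intro carrier_sum carrier_scaleR basis_mem)

lemma ip_comb_left: "h \<in> X \<Longrightarrow> ip (\<Sum>k\<in>F. c k *\<^sub>R e k) h = (\<Sum>k\<in>F. c k * ip (e k) h)"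
  by (simp add: ip_sum_left ip_scaleR_left carrier_scaleR basis_mem)

lemma ip_comb_basis:
  assumes "finite F"
  shows "ip (\<Sum>k\<in>F. c k *\<^sub>R e k) (e j) = (if j \<in> F then c j else 0)"
proof -
  have "ip (\<Sum>k\<in>F. c k *\<^sub>R e k) (e j) = (\<Sum>k\<in>F. if k = j then c k else 0)"
    by (subst ip_comb_left) (auto simp: basis_mem ip_basis intro!: sum.cong)
  then show ?thesis using assms by simp
qed

lemma ip_comb_comb:
  assumes "finite F"
  shows "ip (\<Sum>k\<in>F. c k *\<^sub>R e k) (\<Sum>k\<in>F. c k *\<^sub>R e k) = (\<Sum>k\<in>F. (c k)\<^sup>2)"
proof -
  have "ip (\<Sum>k\<in>F. c k *\<^sub>R e k) (\<Sum>k\<in>F. c k *\<^sub>R e k) = (\<Sum>j\<in>F. c j * ip (\<Sum>k\<in>F. c k *\<^sub>R e k) (e j))"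
    by (subst ip_comb_left[OF comb_mem]) (simp add: ip_commute comb_mem basis_mem)
  also have "\<dots> = (\<Sum>k\<in>F. (c k)\<^sup>2)"
    by (intro sum.cong) (auto simp: ip_comb_basis[OF assms] power2_eq_square)
  finally show ?thesis .
qed

text \<open>Completing the square in each coefficient. The last sum vanishes for the Fourier
  coefficients of \<open>h\<close>, which are therefore the best choice of \<open>c\<close>.\<close>

lemma ip_diff_comb:
  assumes "finite F" "h \<in> X"
  shows "ip (h - (\<Sum>k\<in>F. c k *\<^sub>R e k)) (h - (\<Sum>k\<in>F. c k *\<^sub>R e k)) =
    ip h h - (\<Sum>k\<in>F. (ip h (e k))\<^sup>2) + (\<Sum>k\<in>F. (ip h (e k) - c k)\<^sup>2)"
proof -
  have "ip h (\<Sum>k\<in>F. c k *\<^sub>R e k) = (\<Sum>k\<in>F. c k * ip h (e k))"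
    using assms by (simp add: ip_commute[of h] comb_mem basis_mem ip_comb_left)
  then show ?thesis
    using assms
    by (simp add: ip_diff_diff comb_mem ip_comb_comb power2_diff sum.distrib sum_subtractf
        sum_distrib_left mult_ac)
qed

lemma inj_basis: "inj e"
  by (rule injI) (metis ip_basis zero_neq_one)

lemma span_basisE:
  assumes "g \<in> span (range e)"
  obtains F c where "finite F" "g = (\<Sum>k\<in>F. c k *\<^sub>R e k)"
proof -
  from assms obtain t r where t: "finite t" "t \<subseteq> range e" "g = (\<Sum>a\<in>t. r a *\<^sub>R a)"
    unfolding span_explicit by auto
  then obtain F where F: "t = e ` F" by (meson subset_imageE)
  have inj: "inj_on e F" using inj_basis by (rule inj_on_subset) auto
  show thesis
    using that[of F "\<lambda>k. r (e k)"] t F inj by (simp add: finite_image_iff sum.reindex)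
qed

text \<open>The partial sum of the expansion of \<open>h\<close> is at least as close to \<open>h\<close> as any approximation
  supported on the same indices, so density bounds the norm by the coefficients.\<close>

lemma ip_le_if_dense:
  assumes dense: "\<And>\<epsilon>. \<epsilon> > 0 \<Longrightarrow> \<exists>g\<in>span (range e). ip (h - g) (h - g) < \<epsilon>"
    and h: "h \<in> X"
    and bound: "\<And>F. finite F \<Longrightarrow> (\<Sum>k\<in>F. (ip h (e k))\<^sup>2) \<le> D"
  shows "ip h h \<le> D"
proof (rule field_le_epsilon)
  fix \<epsilon> :: real assume "\<epsilon> > 0"
  then obtain g where g: "g \<in> span (range e)" "ip (h - g) (h - g) < \<epsilon>" using dense by blast
  from g(1) obtain F c where F: "finite F" "g = (\<Sum>k\<in>F. c k *\<^sub>R e k)" by (rule span_basisE)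
  have "ip h h - (\<Sum>k\<in>F. (ip h (e k))\<^sup>2) \<le> ip (h - g) (h - g)"
    unfolding F(2) ip_diff_comb[OF F(1) h] by (simp add: sum_nonneg)
  with g(2) bound[OF F(1)] show "ip h h \<le> D + \<epsilon>" by linarith
qed

text \<open>The competing subspace is spanned by the basis vectors with index in \<open>G\<close>,
  and \<open>f\<close> is approximated by its orthogonal projection. Bounds on finite sums outside
  \<open>G\<close> suffice, because density turns them into a bound on the whole residual.\<close>

theorem kolmogorov_width_le:
  assumes dense: "\<And>f \<epsilon>. \<lbrakk>f \<in> X; \<epsilon> > 0\<rbrakk> \<Longrightarrow> \<exists>g\<in>span (range e). ip (f - g) (f - g) < \<epsilon>"
    and G: "finite G" "card G \<le> N" and W: "W \<subseteq> X" and \<delta>: "\<delta> \<ge> 0"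
    and tail: "\<And>f F. \<lbrakk>f \<in> W; finite F; F \<inter> G = {}\<rbrakk> \<Longrightarrow> (\<Sum>k\<in>F. (ip f (e k))\<^sup>2) \<le> \<delta>\<^sup>2"
  shows "kolmogorov_width N W X (\<lambda>f. sqrt (ip f f)) \<le> ereal \<delta>"
proof -
  define L where "L = span (e ` G)"
  have L: "L \<in> {L. subspace L \<and> L \<subseteq> X \<and> (\<exists>B. finite B \<and> card B \<le> N \<and> L = span B)}"
  proof -
    have "L \<subseteq> X" unfolding L_def by (rule span_minimal) (auto simp: basis_mem subspace_carrier)
    moreover have "card (e ` G) \<le> N" using card_image_le[OF G(1)] G(2) order_trans by blast
    ultimately show ?thesis using G(1) by (auto simp: L_def intro!: exI[of _ "e ` G"])
  qed
  have "(SUP f\<in>W. INF g\<in>L. ereal (sqrt (ip (f - g) (f - g)))) \<le> ereal \<delta>"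
  proof (rule SUP_least)
    fix f assume f: "f \<in> W"
    then have fX: "f \<in> X" using W by blast
    define g where "g = (\<Sum>k\<in>G. ip f (e k) *\<^sub>R e k)"
    have gX: "g \<in> X" unfolding g_def by (rule comb_mem)
    have gL: "g \<in> L" unfolding g_def L_def by (intro span_sum span_scale span_base) auto
    have coeff: "ip (f - g) (e k) = (if k \<in> G then 0 else ip f (e k))" for k
      using fX gX by (simp add: ip_diff_left basis_mem) (simp add: g_def ip_comb_basis G)
    have "ip (f - g) (f - g) \<le> \<delta>\<^sup>2"
    proof (rule ip_le_if_dense)
      show "f - g \<in> X" using fX gX by (rule carrier_diff)
      then show "\<exists>g'\<in>span (range e). ip (f - g - g') (f - g - g') < \<epsilon>" if "\<epsilon> > 0" for \<epsilon>
        using dense that by blast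
      fix F :: "'k set" assume F: "finite F"
      have "(\<Sum>k\<in>F. (ip (f - g) (e k))\<^sup>2) = (\<Sum>k\<in>F - G. (ip f (e k))\<^sup>2)"
        by (rule sum.mono_neutral_cong_right) (use F in \<open>auto simp: coeff\<close>)
      also have "\<dots> \<le> \<delta>\<^sup>2" using F f by (intro tail) auto
      finally show "(\<Sum>k\<in>F. (ip (f - g) (e k))\<^sup>2) \<le> \<delta>\<^sup>2" .
    qed
    then have "sqrt (ip (f - g) (f - g)) \<le> \<delta>" using \<delta> by (simp add: real_le_lsqrt)
    then show "(INF g\<in>L. ereal (sqrt (ip (f - g) (f - g)))) \<le> ereal \<delta>"
      using gL by (intro INF_lower2[of g]) auto
  qed
  then show ?thesis
    unfolding kolmogorov_width_def by (intro INF_lower2[OF L])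
qed

text \<open>Some combination of the \<open>e k\<close>, \<open>k \<in> G\<close>, of norm \<open>\<delta>\<close> is orthogonal to a given subspace of
  dimension less than \<open>card G\<close>.\<close>

theorem kolmogorov_width_ge:
  assumes G: "finite G" "N < card G" and \<delta>: "\<delta> \<ge> 0"
    and W: "\<And>c. (\<Sum>k\<in>G. (c k)\<^sup>2) = \<delta>\<^sup>2 \<Longrightarrow> (\<Sum>k\<in>G. c k *\<^sub>R e k) \<in> W"
  shows "ereal \<delta> \<le> kolmogorov_width N W X (\<lambda>f. sqrt (ip f f))"
  unfolding kolmogorov_width_def
proof (rule INF_greatest, clarify)
  fix B :: "'v set" assume B: "finite B" "card B \<le> N" "span B \<subseteq> X"
  have BX: "b \<in> X" if "b \<in> B" for b using that B(3) span_base by blast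
  \<comment> \<open>Orthogonality to \<open>B\<close> is a homogeneous linear system with at most
    \<open>N\<close> equations and \<open>card G > N\<close> unknowns.\<close>
  obtain c where c: "\<exists>k\<in>G. c k \<noteq> 0" "\<And>b. b \<in> B \<Longrightarrow> (\<Sum>k\<in>G. c k * ip (e k) b) = 0"
    using underdetermined_system[OF B(1) G(1), of "\<lambda>k b. ip (e k) b"] G(2) B(2) by fastforce
  define S where "S = (\<Sum>k\<in>G. (c k)\<^sup>2)"
  have S: "S > 0"
  proof -
    obtain k where "k \<in> G" "c k \<noteq> 0" using c(1) by blast
    then show ?thesis unfolding S_def using G(1) by (intro sum_pos2[of _ k]) auto
  qed
  \<comment> \<open>Rescaling to norm \<open>\<delta>\<close> preserves the orthogonality and puts
    the combination into \<open>W\<close>.\<close>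
  define d where "d k = \<delta> / sqrt S * c k" for k
  have d_sq: "(\<Sum>k\<in>G. (d k)\<^sup>2) = \<delta>\<^sup>2"
  proof -
    have "(\<Sum>k\<in>G. (d k)\<^sup>2) = (\<delta> / sqrt S)\<^sup>2 * S"
      unfolding d_def power_mult_distrib S_def by (rule sum_distrib_left[symmetric])
    then show ?thesis using S by (simp add: power_divide)
  qed
  define f where "f = (\<Sum>k\<in>G. d k *\<^sub>R e k)"
  have fX: "f \<in> X" unfolding f_def by (rule comb_mem)
  have orth_B: "ip f b = 0" if "b \<in> B" for b
  proof -
    have "ip f b = (\<Sum>k\<in>G. \<delta> / sqrt S * (c k * ip (e k) b))"
      by (simp add: f_def ip_comb_left BX that d_def mult.assoc)
    also have "\<dots> = 0" unfolding sum_distrib_left[symmetric] c(2)[OF that] by simp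
    finally show ?thesis .
  qed
  have orth: "ip f g = 0" if g: "g \<in> span B" for g
  proof -
    obtain r where "g = (\<Sum>b\<in>B. r b *\<^sub>R b)" using g unfolding span_finite[OF B(1)] by blast
    moreover have "ip (\<Sum>b\<in>B. r b *\<^sub>R b) f = (\<Sum>b\<in>B. r b * ip b f)"
      using fX BX by (simp add: ip_sum_left ip_scaleR_left carrier_scaleR)
    moreover have "(\<Sum>b\<in>B. r b * ip b f) = 0"
      using orth_B fX BX by (intro sum.neutral) (auto simp: ip_commute)
    ultimately show ?thesis using fX g B(3) ip_commute by (metis subsetD)
  qed
  have "ereal \<delta> \<le> (INF g\<in>span B. ereal (sqrt (ip (f - g) (f - g))))"
  proof (rule INF_greatest)
    fix g assume g: "g \<in> span B"
    then have gX: "g \<in> X" using B(3) by blast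
    have "\<delta>\<^sup>2 = ip f f" unfolding f_def using G(1) by (simp add: ip_comb_comb d_sq)
    \<comment> \<open>Pythagoras: the right-hand side equals \<open>ip f f + ip g g\<close>.\<close>
    also have "\<dots> \<le> ip (f - g) (f - g)"
      using orth[OF g] ip_nonneg[OF gX] by (simp add: ip_diff_diff fX gX)
    finally show "ereal \<delta> \<le> ereal (sqrt (ip (f - g) (f - g)))"
      by (simp add: real_le_rsqrt)
  qed
  also have "\<dots> \<le> (SUP f\<in>W. INF g\<in>span B. ereal (sqrt (ip (f - g) (f - g))))"
    using W[OF d_sq] by (intro SUP_upper) (simp add: f_def)
  finally show "ereal \<delta> \<le> (SUP f\<in>W. INF g\<in>span B. ereal (sqrt (ip (f - g) (f - g))))" .
qed

end

section \<open>Counting the points of a hyperbolic cross\<close>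

text \<open>A discrete mean value theorem: in the factorisation of the difference, each of the
  \<open>Suc n\<close> summands lies between \<open>v ^ n\<close> and \<open>u ^ n\<close>. The
  first bound serves the upper count of the hyperbolic cross, the second the lower count.\<close>

lemma power_Suc_diff_bounds:
  fixes u v :: real
  assumes "0 \<le> v" "v \<le> u"
  shows "real (Suc n) * v ^ n * (u - v) \<le> u ^ Suc n - v ^ Suc n"
    and "u ^ Suc n - v ^ Suc n \<le> real (Suc n) * u ^ n * (u - v)"
proof -
  have eq: "u ^ Suc n - v ^ Suc n = (u - v) * (\<Sum>i<Suc n. v ^ (n - i) * u ^ i)"
    using power_diff_sumr2[of u "Suc n" v] by simp
  have "(\<Sum>i<Suc n. v ^ n) \<le> (\<Sum>i<Suc n. v ^ (n - i) * u ^ i)"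
  proof (rule sum_mono)
    fix i assume "i \<in> {..<Suc n}"
    then have "v ^ n = v ^ (n - i) * v ^ i" by (simp flip: power_add)
    also have "\<dots> \<le> v ^ (n - i) * u ^ i"
      using assms by (intro mult_left_mono power_mono) auto
    finally show "v ^ n \<le> v ^ (n - i) * u ^ i" .
  qed
  from mult_left_mono[OF this, of "u - v"] assms
  show "real (Suc n) * v ^ n * (u - v) \<le> u ^ Suc n - v ^ Suc n"
    unfolding eq by (simp add: mult_ac)
  have "(\<Sum>i<Suc n. v ^ (n - i) * u ^ i) \<le> (\<Sum>i<Suc n. u ^ n)"
  proof (rule sum_mono)
    fix i assume "i \<in> {..<Suc n}"
    then have "u ^ n = u ^ (n - i) * u ^ i" by (simp flip: power_add)
    moreover have "v ^ (n - i) * u ^ i \<le> u ^ (n - i) * u ^ i"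
      using assms by (intro mult_right_mono power_mono) auto
    ultimately show "v ^ (n - i) * u ^ i \<le> u ^ n" by simp
  qed
  from mult_left_mono[OF this, of "u - v"] assms
  show "u ^ Suc n - v ^ Suc n \<le> real (Suc n) * u ^ n * (u - v)"
    unfolding eq by (simp add: mult_ac)
qed

lemma one_over_Suc_le_ln_diff:
  fixes x :: real
  assumes "x > 0"
  shows "1 / (x + 1) \<le> ln (x + 1) - ln x"
proof -
  have "ln (x / (x + 1)) \<le> x / (x + 1) - 1"
    using assms by (intro ln_le_minus_one) simp
  then show ?thesis using assms by (simp add: ln_div field_simps)
qed

lemma ln_diff_le_one_over:
  fixes x :: real
  assumes "x > 0"
  shows "ln (x + 1) - ln x \<le> 1 / x"
proof -
  have "ln ((x + 1) / x) \<le> (x + 1) / x - 1"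
    using assms by (intro ln_le_minus_one) simp
  then show ?thesis using assms by (simp add: ln_div field_simps)
qed

text \<open>An arbitrary index set \<open>A\<close> allows induction on its size. Extensional
  functions have a fixed value outside \<open>A\<close>, so that each lattice point is counted
  once.\<close>

definition hyp_cross :: "real \<Rightarrow> 'i set \<Rightarrow> real \<Rightarrow> ('i \<Rightarrow> nat) set" where
  "hyp_cross a A T = {k \<in> A \<rightarrow>\<^sub>E UNIV. (\<Prod>j\<in>A. a + real (k j)) \<le> T}"

context
  fixes a :: real

  \<comment> \<open>Slicing a hyperbolic cross along one coordinate\<close>
  assumes a_pos: "a > 0"
begin

lemma hyp_cross_eq_empty:
  assumes "finite A" "T < a ^ card A"
  shows "hyp_cross a A T = {}"
proof -
  have "a ^ card A \<le> (\<Prod>j\<in>A. a + real (k j))" for k :: "'a \<Rightarrow> nat"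
    using prod_mono[of A "\<lambda>_. a" "\<lambda>j. a + real (k j)"] a_pos by simp
  then have "\<not> (\<Prod>j\<in>A. a + real (k j)) \<le> T" for k :: "'a \<Rightarrow> nat"
    using assms(2) by (meson not_le order_less_le_trans)
  then show ?thesis unfolding hyp_cross_def by blast
qed

lemma hyp_cross_insert:
  assumes "finite A" "i \<notin> A"
  shows "hyp_cross a (insert i A) T =
    (\<lambda>(n, k). k(i := n)) ` (SIGMA n:UNIV. hyp_cross a A (T / (a + real n)))"
proof -
  have eq: "(\<Prod>j\<in>insert i A. a + real ((k(i := n)) j)) = (\<Prod>j\<in>A. a + real (k j)) * (a + real n)"
    for k n
    using assms by (auto simp: mult_ac intro!: prod.cong)
  have iff: "(\<Prod>j\<in>insert i A. a + real ((k(i := n)) j)) \<le> T \<longleftrightarrow>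
      (\<Prod>j\<in>A. a + real (k j)) \<le> T / (a + real n)" for k n
    unfolding eq using a_pos by (subst pos_le_divide_eq) auto
  show ?thesis
  proof (intro set_eqI iffI)
    fix k assume k: "k \<in> hyp_cross a (insert i A) T"
    \<comment> \<open>Resetting coordinate \<open>i\<close> to the default value makes
      \<open>k'\<close> extensional on \<open>A\<close>.\<close>
    define k' where "k' = k(i := undefined)"
    have k': "k = k'(i := k i)" by (simp add: k'_def)
    have "(\<Prod>j\<in>A. a + real (k' j)) \<le> T / (a + real (k i))"
      using k iff[of k' "k i"] unfolding k'[symmetric] hyp_cross_def by blast
    moreover have "k' \<in> A \<rightarrow>\<^sub>E UNIV"
      using k assms(2) by (auto simp: hyp_cross_def k'_def PiE_def extensional_def)
    ultimately have "k' \<in> hyp_cross a A (T / (a + real (k i)))" by (simp add: hyp_cross_def)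
    then show "k \<in> (\<lambda>(n, k). k(i := n)) ` (SIGMA n:UNIV. hyp_cross a A (T / (a + real n)))"
      using k' by (intro image_eqI[of _ _ "(k i, k')"]) auto
  next
    fix k assume "k \<in> (\<lambda>(n, k). k(i := n)) ` (SIGMA n:UNIV. hyp_cross a A (T / (a + real n)))"
    then obtain n k' where k: "k = k'(i := n)" "k' \<in> hyp_cross a A (T / (a + real n))" by auto
    then have "(\<Prod>j\<in>insert i A. a + real (k j)) \<le> T"
      using iff[of k' n] by (simp only: hyp_cross_def mem_Collect_eq)
    moreover have "k \<in> insert i A \<rightarrow>\<^sub>E UNIV"
      using k by (auto simp: hyp_cross_def PiE_def extensional_def)
    ultimately show "k \<in> hyp_cross a (insert i A) T" by (simp only: hyp_cross_def mem_Collect_eq)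
  qed
qed

lemma inj_on_hyp_cross_insert:
  assumes "i \<notin> A"
  shows "inj_on (\<lambda>(n, k). k(i := n)) (SIGMA n:UNIV. hyp_cross a A (g n))"
proof (rule inj_onI, clarify)
  fix n n' k k'
  assume *: "k \<in> hyp_cross a A (g n)" "k' \<in> hyp_cross a A (g n')" "k(i := n) = k'(i := n')"
  have "k i = undefined" "k' i = undefined"
    using * assms by (auto simp: hyp_cross_def PiE_def extensional_def)
  moreover have "k j = k' j" if "j \<noteq> i" for j
    using fun_cong[OF *(3), of j] that by simp
  ultimately have "k j = k' j" for j by (cases "j = i") auto
  then show "n = n' \<and> k = k'" using fun_cong[OF *(3), of i] by auto
qed

text \<open>For \<open>n > m\<close> the parameter of the slice is below \<open>a ^ card A\<close>,
  the least possible product, so the disjoint union over all \<open>n\<close> is really a finite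
  one.\<close>

lemma finite_card_hyp_cross_insert:
  assumes "finite A" "i \<notin> A" "\<And>S. finite (hyp_cross a A S)"
    and m: "m \<ge> nat \<lceil>T / a ^ card A\<rceil>"
  shows "finite (hyp_cross a (insert i A) T)"
    and "card (hyp_cross a (insert i A) T) = (\<Sum>n\<le>m. card (hyp_cross a A (T / (a + real n))))"
proof -
  have empty: "hyp_cross a A (T / (a + real n)) = {}" if "n > m" for n
  proof (rule hyp_cross_eq_empty[OF assms(1)])
    have "T / a ^ card A \<le> m" using m by linarith
    also have "real m < a + real n" using that a_pos by simp
    finally show "T / (a + real n) < a ^ card A" using a_pos by (simp add: field_simps)
  qed
  have eq: "(SIGMA n:UNIV. hyp_cross a A (T / (a + real n))) = (SIGMA n:{..m}. hyp_cross a A (T / (a + real n)))"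
    using empty by (auto simp: not_le[symmetric])
  show "finite (hyp_cross a (insert i A) T)"
    unfolding hyp_cross_insert[OF assms(1,2)] eq using assms(3) by auto
  show "card (hyp_cross a (insert i A) T) = (\<Sum>n\<le>m. card (hyp_cross a A (T / (a + real n))))"
    unfolding hyp_cross_insert[OF assms(1,2)]
    by (subst card_image[OF inj_on_hyp_cross_insert[OF assms(2)]]) (simp add: eq card_SigmaI assms(3))
qed

lemma finite_hyp_cross: "finite A \<Longrightarrow> finite (hyp_cross a A T)"
proof (induction A arbitrary: T rule: finite_induct)
  case empty
  then show ?case by (simp add: hyp_cross_def)
next
  case (insert i A)
  then show ?case by (intro finite_card_hyp_cross_insert(1)[OF _ _ _ order_refl])
qed

lemma card_hyp_cross_singleton:
  fixes i :: 'i
  assumes "T \<ge> a"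
  shows "card (hyp_cross a {i} T) = nat \<lfloor>T - a\<rfloor> + 1"
proof -
  define m where "m = nat \<lceil>T\<rceil> "
  \<comment> \<open>Over the empty index set the product is 1 and the only extensional function is
    constantly \<open>undefined\<close>; a slice contributes one point or none.\<close>
  have eq: "hyp_cross a {} (T / (a + real n)) = (if n \<le> nat \<lfloor>T - a\<rfloor> then {\<lambda>_. undefined} else {})" for n
  proof -
    have "1 \<le> T / (a + real n) \<longleftrightarrow> n \<le> nat \<lfloor>T - a\<rfloor>"
    proof -
      have "1 \<le> T / (a + real n) \<longleftrightarrow> real n \<le> T - a"
        using a_pos by (simp add: field_simps)
      also have "\<dots> \<longleftrightarrow> n \<le> nat \<lfloor>T - a\<rfloor>"
        using assms by linarith
      finally show ?thesis .
    qed
    then show ?thesis by (auto simp: hyp_cross_def)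
  qed
  have "card (hyp_cross a {i} T) = (\<Sum>n\<le>m. card (hyp_cross a {} (T / (a + real n)) :: ('i \<Rightarrow> nat) set))"
    by (rule finite_card_hyp_cross_insert(2)) (simp_all add: finite_hyp_cross m_def)
  also have "\<dots> = (\<Sum>n\<in>{..m}. if n \<le> nat \<lfloor>T - a\<rfloor> then 1 else 0)"
    unfolding eq by (intro sum.cong) auto
  also have "\<dots> = card ({..m} \<inter> {n. n \<le> nat \<lfloor>T - a\<rfloor>})"
    by (simp add: sum.If_cases)
  also have "{..m} \<inter> {n. n \<le> nat \<lfloor>T - a\<rfloor>} = {..nat \<lfloor>T - a\<rfloor>}"
  proof -
    have "\<lfloor>T - a\<rfloor> \<le> \<lceil>T\<rceil>" using a_pos by linarith
    then have "nat \<lfloor>T - a\<rfloor> \<le> m" unfolding m_def by (rule nat_mono)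
    then show ?thesis by auto
  qed
  finally show ?thesis by simp
qed

text \<open>The base of the power is \<open>ln (T / a ^ Suc n)\<close> plus \<open>n / a\<close>.
  Each of the \<open>n\<close> induction steps costs \<open>1 / a\<close>, the price of the slice
  \<open>k = 0\<close>, which has no left neighbour in the comparison of \<open>1 / (a + k)\<close>
  with a difference of logarithms.\<close>

theorem card_hyp_cross_le:
  assumes "finite A" "card A = Suc n" "T \<ge> a ^ Suc n"
  shows "real (card (hyp_cross a A T)) \<le>
    max 1 (1 / a) * T * (real n / a + ln T - real (Suc n) * ln a) ^ n / fact n"
  using assms
proof (induction n arbitrary: A T)
  case 0
  then obtain i where A: "A = {i}" by (auto simp: card_Suc_eq)
  have T: "T \<ge> a" using 0 by simp
  have "real (card (hyp_cross a A T)) \<le> T - a + 1"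
    unfolding A card_hyp_cross_singleton[OF T] using T by (simp add: of_nat_nat)
  \<comment> \<open>The constant is fixed here and passes unchanged through the induction. For
    \<open>a < 1\<close> the surplus \<open>1 - a\<close> is absorbed because
    \<open>T \<ge> a\<close>.\<close>
  also have "\<dots> \<le> max 1 (1 / a) * T"
  proof (cases "a \<ge> 1")
    case True
    then show ?thesis using a_pos by (simp add: max_def field_simps)
  next
    case False
    have "(1 - a) * a \<le> (1 - a) * T" using False T by (intro mult_left_mono) auto
    then have "T - a + 1 \<le> T / a" using a_pos by (simp add: field_simps)
    then show ?thesis using False a_pos by (simp add: max_def)
  qed
  finally show ?case by simp
next
  case (Suc n)
  then obtain i A' where A: "A = insert i A'" "i \<notin> A'" "card A' = Suc n" "finite A'"
    by (metis card_Suc_eq finite_insert)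
  define M where "M = max 1 (1 / a)"
  have M: "M \<ge> 1" by (simp add: M_def)
  have T: "T > 0" using Suc.prems(3) a_pos by (meson less_le_trans zero_less_power)
  define D where "D = real n / a + ln T - real (Suc n) * ln a"
  \<comment> \<open>Shifted by one index: slice \<open>k\<close> has base \<open>w (Suc k)\<close>,
    and \<open>1 / (a + k)\<close> is compared with the increment of \<open>ln\<close> to the left
    of \<open>a + k\<close>. For \<open>k = 0\<close> this would involve \<open>ln (a - 1)\<close>;
    the substitute makes the difference exactly \<open>1 / a\<close>.\<close>
  define w where "w k = D - (if k = 0 then ln a - 1 / a else ln (a + real k - 1))" for k :: nat
  \<comment> \<open>After truncation the differences remain nonnegative even where the base is
    negative, so they also bound the empty slices.\<close>
  define z where "z k = (max 0 (w k)) ^ Suc n" for k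
  have w: "1 / (a + real k) \<le> w k - w (Suc k)" for k
  proof (cases k)
    case 0
    then show ?thesis by (simp add: w_def)
  next
    case (Suc l)
    have "1 / (a + real l + 1) \<le> ln (a + real l + 1) - ln (a + real l)"
      by (rule one_over_Suc_le_ln_diff) (use a_pos in auto)
    then show ?thesis by (simp add: w_def Suc add_ac)
  qed
  have w_mono: "w (Suc k) \<le> w k" for k
    using w[of k] a_pos by (smt (verit) divide_nonneg_nonneg of_nat_0_le_iff)
  have step: "real (card (hyp_cross a A' (T / (a + real k)))) \<le> M * T / fact (Suc n) * (z k - z (Suc k))" for k
  proof (cases "T / (a + real k) \<ge> a ^ Suc n")
    case True
    have ak: "a + real k > 0" using a_pos by simp
    have "real (Suc n) * ln a \<le> ln (T / (a + real k))"
      using True a_pos T ak by (metis ln_mono ln_realpow zero_less_power)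
    moreover have "real n / a \<ge> 0" using a_pos by simp
    moreover have "w (Suc k) = real n / a + ln (T / (a + real k)) - real (Suc n) * ln a"
      using T ak by (simp add: w_def D_def ln_div)
    ultimately have w0: "w (Suc k) \<ge> 0" by linarith
    have "real (card (hyp_cross a A' (T / (a + real k)))) \<le>
       M * (T / (a + real k)) * (real n / a + ln (T / (a + real k)) - real (Suc n) * ln a) ^ n / fact n"
      unfolding M_def by (rule Suc.IH) (use A True in auto)
    also have "real n / a + ln (T / (a + real k)) - real (Suc n) * ln a = w (Suc k)"
      using T ak by (simp add: w_def D_def ln_div)
    also have "M * (T / (a + real k)) * w (Suc k) ^ n / fact n =
        M * T / fact (Suc n) * (real (Suc n) * w (Suc k) ^ n * (1 / (a + real k)))"
      by (simp add: field_simps del: of_nat_Suc)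
    also have "\<dots> \<le> M * T / fact (Suc n) * (real (Suc n) * w (Suc k) ^ n * (w k - w (Suc k)))"
      using M T w0 w by (intro mult_left_mono) auto
    also have "\<dots> \<le> M * T / fact (Suc n) * (w k ^ Suc n - w (Suc k) ^ Suc n)"
      using M T w0 w_mono by (intro mult_left_mono power_Suc_diff_bounds) auto
    also have "w k ^ Suc n - w (Suc k) ^ Suc n = z k - z (Suc k)"
      using w0 w_mono[of k] by (simp add: z_def max_def)
    finally show ?thesis .
  next
    case False
    then have "hyp_cross a A' (T / (a + real k)) = {}"
      using A by (intro hyp_cross_eq_empty) auto
    moreover have "z (Suc k) \<le> z k" unfolding z_def using w_mono[of k] by (intro power_mono) auto
    ultimately show ?thesis using M T by simp
  qed
  define m where "m = nat \<lceil>T / a ^ card A'\<rceil>"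
  have "real (card (hyp_cross a A T)) = (\<Sum>k\<le>m. real (card (hyp_cross a A' (T / (a + real k)))))"
    unfolding A(1) by (subst finite_card_hyp_cross_insert(2)[where m = m]) (use A finite_hyp_cross m_def in auto)
  also have "\<dots> \<le> (\<Sum>k\<le>m. M * T / fact (Suc n) * (z k - z (Suc k)))"
    by (intro sum_mono step)
  also have "\<dots> = M * T / fact (Suc n) * (z 0 - z (Suc m))"
    unfolding sum_distrib_left[symmetric] sum_telescope ..
  also have "\<dots> \<le> M * T / fact (Suc n) * z 0"
    using M T by (intro mult_left_mono) (auto simp: z_def)
  also have "z 0 = w 0 ^ Suc n"
  proof -
    have "real (Suc (Suc n)) * ln a \<le> ln T"
      using Suc.prems(3) a_pos T by (metis ln_mono ln_realpow zero_less_power)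
    moreover have "real n / a \<ge> 0" "1 / a \<ge> 0" using a_pos by simp_all
    moreover have "w 0 = 1 / a + real n / a + (ln T - real (Suc (Suc n)) * ln a)"
      by (simp add: w_def D_def algebra_simps)
    ultimately have "w 0 \<ge> 0" by linarith
    then show ?thesis by (simp add: z_def)
  qed
  also have "w 0 = real (Suc n) / a + ln T - real (Suc (Suc n)) * ln a"
    by (simp add: w_def D_def algebra_simps add_divide_distrib)
  finally show ?case by (simp add: M_def)
qed

text \<open>Here the increments of \<open>ln\<close> are taken to the right of \<open>a + k\<close>,
  so \<open>k = 0\<close> is no exception. The factor 1/2 comes from
  \<open>T - a \<ge> T / 2\<close> in dimension one; the condition \<open>T \<ge> 2 * a\<close>
  behind it puts \<open>ln 2\<close> into the base.\<close>

theorem card_hyp_cross_ge: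
  assumes "finite A" "card A = Suc n" "T \<ge> 2 * a ^ Suc n"
  shows "T / 2 * (ln T - ln 2 - real (Suc n) * ln a) ^ n / fact n \<le> real (card (hyp_cross a A T))"
  using assms
proof (induction n arbitrary: A T)
  case 0
  then obtain i where A: "A = {i}" by (auto simp: card_Suc_eq)
  have T: "T \<ge> a" using 0 a_pos by simp
  have "T / 2 \<le> T - a" using 0 by simp
  also have "\<dots> \<le> real (card (hyp_cross a A T))"
    unfolding A card_hyp_cross_singleton[OF T] using T by linarith
  finally show ?case by simp
next
  case (Suc n)
  then obtain i A' where A: "A = insert i A'" "i \<notin> A'" "card A' = Suc n" "finite A'"
    by (metis card_Suc_eq finite_insert)
  have ap: "a ^ k > 0" for k using a_pos by simp
  have T: "T > 0" using Suc.prems(3) ap[of "Suc (Suc n)"] by linarith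
  define C where "C = ln T - ln 2 - real (Suc n) * ln a"
  define u where "u k = max 0 (C - ln (a + real k))" for k
  have u_mono: "u (Suc k) \<le> u k" for k
    unfolding u_def using a_pos by (intro max.mono diff_mono ln_mono) auto
  have u_nn: "u k \<ge> 0" for k by (simp add: u_def)
  have u_diff: "u k - u (Suc k) \<le> 1 / (a + real k)" for k
  proof -
    have "ln (a + real k + 1) - ln (a + real k) \<le> 1 / (a + real k)"
      by (rule ln_diff_le_one_over) (use a_pos in auto)
    moreover have "1 / (a + real k) \<ge> 0" using a_pos by simp
    moreover have "ln (a + real k) \<le> ln (a + real k + 1)" using a_pos by (intro ln_mono) auto
    moreover have "ln (a + real (Suc k)) = ln (a + real k + 1)" by (simp add: add_ac)
    ultimately show ?thesis unfolding u_def by linarith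
  qed
  \<comment> \<open>The induction hypothesis covers slice \<open>k\<close> exactly when its base is
    nonnegative. For all other slices the truncated base is 0 and the trivial bound
    suffices.\<close>
  have iff: "T / (a + real k) \<ge> 2 * a ^ Suc n \<longleftrightarrow> C - ln (a + real k) \<ge> 0" for k
  proof -
    have ak: "a + real k > 0" using a_pos by simp
    have "T / (a + real k) \<ge> 2 * a ^ Suc n \<longleftrightarrow> ln (2 * a ^ Suc n) \<le> ln (T / (a + real k))"
      using T ak ap[of "Suc n"] by (subst ln_le_cancel_iff) auto
    also have "ln (2 * a ^ Suc n) = ln 2 + real (Suc n) * ln a"
      using a_pos ap[of "Suc n"] by (subst ln_mult_pos) (simp_all add: ln_realpow del: power_Suc)
    also have "ln (T / (a + real k)) = ln T - ln (a + real k)"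
      using T ak by (simp add: ln_div)
    finally show ?thesis by (auto simp: C_def)
  qed
  have step: "T / 2 / fact (Suc n) * (u k ^ Suc n - u (Suc k) ^ Suc n)
      \<le> real (card (hyp_cross a A' (T / (a + real k))))" for k
  proof (cases "T / (a + real k) \<ge> 2 * a ^ Suc n")
    case True
    have ak: "a + real k > 0" using a_pos by simp
    have uk: "u k = C - ln (a + real k)" using True iff by (simp add: u_def)
    have "T / 2 / fact (Suc n) * (u k ^ Suc n - u (Suc k) ^ Suc n) \<le>
        T / 2 / fact (Suc n) * (real (Suc n) * u k ^ n * (u k - u (Suc k)))"
      using T u_mono u_nn by (intro mult_left_mono power_Suc_diff_bounds) auto
    also have "\<dots> \<le> T / 2 / fact (Suc n) * (real (Suc n) * u k ^ n * (1 / (a + real k)))"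
      using T u_diff u_nn by (intro mult_left_mono) auto
    also have "\<dots> = T / (a + real k) / 2 * u k ^ n / fact n"
      by (simp add: field_simps del: of_nat_Suc)
    also have "\<dots> = T / (a + real k) / 2 * (ln (T / (a + real k)) - ln 2 - real (Suc n) * ln a) ^ n / fact n"
      using T ak by (simp add: uk C_def ln_div algebra_simps)
    also have "\<dots> \<le> real (card (hyp_cross a A' (T / (a + real k))))"
      by (rule Suc.IH) (use A True in auto)
    finally show ?thesis .
  next
    case False
    then have "u k = 0" using iff by (simp add: u_def)
    moreover have "u (Suc k) = 0" using u_mono[of k] u_nn[of "Suc k"] calculation by linarith
    ultimately show ?thesis by simp
  qed
  define m where "m = nat \<lceil>T / a ^ card A'\<rceil>"
  \<comment> \<open>All nonempty slices have index at most \<open>m\<close>, so the telescoping sum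
    loses nothing at its far end.\<close>
  have um: "u (Suc m) = 0"
  proof -
    have "T / a ^ Suc n < a + real (Suc m)" using a_pos unfolding m_def A(3) by linarith
    then have "T / (a + real (Suc m)) < a ^ Suc n"
      using a_pos ap[of "Suc n"] by (simp add: field_simps)
    then have "\<not> T / (a + real (Suc m)) \<ge> 2 * a ^ Suc n" using ap[of "Suc n"] by linarith
    then show ?thesis unfolding iff by (simp add: u_def)
  qed
  have tele: "(\<Sum>k\<le>m. u k ^ Suc n - u (Suc k) ^ Suc n) = u 0 ^ Suc n"
    using sum_telescope[of "\<lambda>k. u k ^ Suc n" m] um by simp
  have "T / 2 / fact (Suc n) * u 0 ^ Suc n = (\<Sum>k\<le>m. T / 2 / fact (Suc n) * (u k ^ Suc n - u (Suc k) ^ Suc n))"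
    unfolding sum_distrib_left[symmetric] tele ..
  also have "\<dots> \<le> (\<Sum>k\<le>m. real (card (hyp_cross a A' (T / (a + real k)))))"
    by (intro sum_mono step)
  also have "\<dots> = real (card (hyp_cross a A T))"
    unfolding A(1) by (subst finite_card_hyp_cross_insert(2)[where m = m]) (use A finite_hyp_cross m_def in auto)
  also have "u 0 = ln T - ln 2 - real (Suc (Suc n)) * ln a"
  proof -
    have "T / (a + real 0) \<ge> 2 * a ^ Suc n" using Suc.prems(3) a_pos by (simp add: field_simps)
    then show ?thesis using iff[of 0] by (simp add: u_def C_def algebra_simps)
  qed
  finally show ?case by (simp add: field_simps)
qed

end

section \<open>Completeness of the tensor Jacobi polynomials\<close>

lemma Basis_cart: "(Basis :: (real ^ 's::finite) set) = range (\<lambda>j. axis j 1)"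
  by (auto simp: Basis_vec_def)

lemma inj_axis_one: "inj (\<lambda>j::'s::finite. axis j (1::real))"
  by (auto simp: inj_on_def axis_eq_axis)

text \<open>Fubini for product functions: \<open>lborel\<close> on \<open>real ^ 's\<close> is the
  image of the product measure over \<open>Basis\<close> under \<open>T\<close>, and
  \<open>idx\<close> translates basis vectors back into coordinates.\<close>

lemma lborel_prod_cart:
  fixes f :: "'s::finite \<Rightarrow> real \<Rightarrow> real"
  assumes int: "\<And>j. integrable lborel (f j)"
  shows "integrable lborel (\<lambda>x::real ^ 's. \<Prod>j\<in>UNIV. f j (x $ j))"
    and "(LINT x|lborel. (\<Prod>j\<in>UNIV. f j ((x::real ^ 's) $ j))) = (\<Prod>j\<in>UNIV. (LINT t|lborel. f j t))"
proof -
  interpret product_sigma_finite "\<lambda>_::real ^ 's. lborel :: real measure"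
    by standard
  have [measurable]: "f j \<in> borel_measurable borel" for j
    using borel_measurable_integrable[OF int] by simp
  define idx where "idx = the_inv (\<lambda>j::'s. axis j (1::real))"
  have idx: "idx (axis j 1) = j" for j
    unfolding idx_def by (rule the_inv_f_f[OF inj_axis_one])
  have reindex: "(\<Prod>b\<in>Basis. F b) = (\<Prod>j\<in>UNIV. F (axis j 1))" for F :: "real ^ 's \<Rightarrow> real"
    unfolding Basis_cart by (simp add: prod.reindex[OF inj_axis_one])
  define T where "T = (\<lambda>y :: real ^ 's \<Rightarrow> real. \<Sum>b\<in>Basis. y b *\<^sub>R b)"
  have T: "T y $ j = y (axis j 1)" for y j
    unfolding T_def Basis_cart
    by (simp add: sum.reindex[OF inj_axis_one]) (simp add: axis_def if_distrib cong: if_cong)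
  have lborel: "(lborel :: (real ^ 's) measure) = distr (\<Pi>\<^sub>M b\<in>Basis. lborel) borel T"
    unfolding T_def by (rule lborel_eq)
  have [measurable]: "T \<in> borel_measurable (\<Pi>\<^sub>M b\<in>Basis. lborel)"
    unfolding T_def by measurable
  have eq: "(\<Prod>j\<in>UNIV. f j (T y $ j)) = (\<Prod>b\<in>Basis. f (idx b) (y b))" for y
    by (simp add: T reindex idx)
  have "integrable (\<Pi>\<^sub>M b\<in>Basis. lborel) (\<lambda>y. \<Prod>b\<in>Basis. f (idx b) (y b))"
    by (rule product_integrable_prod) (auto simp: int)
  then show "integrable lborel (\<lambda>x::real ^ 's. \<Prod>j\<in>UNIV. f j (x $ j))"
    unfolding lborel by (subst integrable_distr_eq) (auto simp: eq)
  have "(LINT y|(\<Pi>\<^sub>M b\<in>(Basis :: (real ^ 's) set). lborel). (\<Prod>b\<in>Basis. f (idx b) (y b))) = (\<Prod>b\<in>(Basis :: (real ^ 's) set). (LINT t|lborel. f (idx b) t))"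
    by (rule product_integral_prod) (auto simp: int)
  then show "(LINT x|lborel. (\<Prod>j\<in>UNIV. f j ((x::real ^ 's) $ j))) = (\<Prod>j\<in>UNIV. (LINT t|lborel. f j t))"
    unfolding lborel by (subst integral_distr) (auto simp: eq reindex idx)
qed

lemma cube_eq_cbox: "cube = cbox (\<chi> j. - 1) (\<chi> j. 1)"
  by (auto simp: cube_def mem_box_cart)

lemma compact_cube: "compact cube"
  by (simp add: cube_eq_cbox)

lemma sets_cube [measurable, simp]: "cube \<in> sets borel"
  by (simp add: cube_eq_cbox)

lemma sets_lebesgue_cube [simp]: "cube \<in> sets lebesgue"
  by (simp add: cube_eq_cbox)

text \<open>For Borel integrands the completion changes neither integrability nor the integral. This
  leads from \<open>lebesgue_on\<close> to \<open>lborel\<close>, for which the product formula is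
  available.\<close>

lemma lebesgue_on_borel:
  fixes f :: "'a::euclidean_space \<Rightarrow> real"
  assumes f [measurable]: "f \<in> borel_measurable borel" and S [measurable]: "S \<in> sets borel"
  shows "integrable (lebesgue_on S) f \<longleftrightarrow> integrable lborel (\<lambda>x. indicator S x * f x)"
    and "(LINT x|lebesgue_on S. f x) = (LINT x|lborel. indicator S x * f x)"
proof -
  have S': "S \<inter> space lebesgue \<in> sets lebesgue" using S by simp
  show "integrable (lebesgue_on S) f \<longleftrightarrow> integrable lborel (\<lambda>x. indicator S x * f x)"
    unfolding integrable_restrict_space[OF S'] by (simp add: integrable_completion)
  show "(LINT x|lebesgue_on S. f x) = (LINT x|lborel. indicator S x * f x)"
    unfolding integral_restrict_space[OF S'] by (simp add: integral_completion)
qed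

lemma lebesgue_on_cube_prod:
  fixes f :: "'s::finite \<Rightarrow> real \<Rightarrow> real"
  assumes [measurable]: "\<And>j. f j \<in> borel_measurable borel"
    and int: "\<And>j. integrable (lebesgue_on {-1..1}) (f j)"
  shows "integrable (lebesgue_on cube) (\<lambda>x. \<Prod>j\<in>UNIV. f j (x $ j))"
    and "(LINT x|lebesgue_on cube. (\<Prod>j\<in>UNIV. f j (x $ j))) = (\<Prod>j\<in>UNIV. LINT t|lebesgue_on {-1..1}. f j t)"
proof -
  have int': "integrable lborel (\<lambda>t. indicator {-1..1} t * f j t)" for j
    using int by (simp add: lebesgue_on_borel)
  have eq: "indicator cube x * (\<Prod>j\<in>UNIV. f j (x $ j)) = (\<Prod>j\<in>UNIV. indicator {-1..1} (x $ j) * f j (x $ j))"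
    for x :: "real ^ 's"
  proof (cases "x \<in> cube")
    case True
    then have "indicator {-1..1} (x $ j) = (1::real)" for j by (auto simp: cube_def)
    with True show ?thesis by simp
  next
    case False
    then obtain j where "x $ j \<notin> {-1..1}" unfolding cube_def by blast
    then have "indicator {-1..1} (x $ j) * f j (x $ j) = 0" by simp
    then have "(\<Prod>j\<in>UNIV. indicator {-1..1} (x $ j) * f j (x $ j)) = 0"
      by (intro prod_zero) auto
    with False show ?thesis by simp
  qed
  have meas: "(\<lambda>x::real ^ 's. \<Prod>j\<in>UNIV. f j (x $ j)) \<in> borel_measurable borel"
    by measurable
  show "integrable (lebesgue_on cube) (\<lambda>x. \<Prod>j\<in>UNIV. f j (x $ j))"
    using lborel_prod_cart(1)[OF int'] by (simp add: lebesgue_on_borel meas eq)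
  show "(LINT x|lebesgue_on cube. (\<Prod>j\<in>UNIV. f j (x $ j))) = (\<Prod>j\<in>UNIV. LINT t|lebesgue_on {-1..1}. f j t)"
    using lborel_prod_cart(2)[OF int'] by (simp add: lebesgue_on_borel meas eq)
qed

lemma continuous_on_jacobi_tensor: "continuous_on A (jacobi_tensor \<alpha> \<beta> k)"
  unfolding jacobi_tensor_def by (intro continuous_intros)

lemma continuous_imp_measurable_cube:
  fixes f :: "real ^ 's \<Rightarrow> real"
  shows "continuous_on UNIV f \<Longrightarrow> f \<in> borel_measurable (lebesgue_on cube)"
  by (rule continuous_imp_measurable_on_sets_lebesgue) (auto elim: continuous_on_subset)

lemma borel_measurable_jacobi_weight [measurable]: "jacobi_weight \<alpha> \<beta> \<in> borel_measurable borel"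
  unfolding jacobi_weight_def by measurable

lemma borel_measurable_poly [measurable]: "poly (p :: real poly) \<in> borel_measurable borel"
  by (intro borel_measurable_continuous_onI continuous_intros)

lemma cube_weight_eq_prod: "cube_weight \<alpha> \<beta> x = (\<Prod>j\<in>UNIV. jacobi_weight \<alpha> \<beta> (x $ j))"
  by (simp add: cube_weight_def jacobi_weight_def)

lemma cube_weight_nonneg: "cube_weight \<alpha> \<beta> x \<ge> 0"
  by (auto simp: cube_weight_def intro!: prod_nonneg)

lemma sum_fun_apply: "(\<Sum>m\<in>A. f m) x = (\<Sum>m\<in>A. f m x)"
  by (induction A rule: infinite_finite_induct) auto

lemma abs_mult_le_add_squares: "\<bar>a * b\<bar> \<le> a\<^sup>2 + (b::real)\<^sup>2"
proof -
  have "0 \<le> (\<bar>a\<bar> - \<bar>b\<bar>)\<^sup>2" by simp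
  then have "2 * (\<bar>a\<bar> * \<bar>b\<bar>) \<le> a\<^sup>2 + b\<^sup>2" by (simp add: power2_diff)
  moreover have "0 \<le> \<bar>a\<bar> * \<bar>b\<bar>" by simp
  ultimately show ?thesis unfolding abs_mult by linarith
qed

section \<open>Square-integrable functions and their approximation by polynomials\<close>

context
  fixes \<alpha> \<beta> :: real
  assumes ab: "\<alpha> > -1" "\<beta> > -1"
begin

lemma integrable_cube_weight: "integrable (lebesgue_on cube) (cube_weight \<alpha> \<beta> :: real ^ 's \<Rightarrow> real)"
  unfolding cube_weight_eq_prod
  by (rule lebesgue_on_cube_prod(1)) (auto simp: integrable_jacobi_weight ab)

lemma borel_measurable_cube_weight [measurable]: "cube_weight \<alpha> \<beta> \<in> borel_measurable (lebesgue_on cube)"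
  using integrable_cube_weight by (rule borel_measurable_integrable)

lemma integrable_bounded_cube_weight:
  fixes h :: "real ^ 's \<Rightarrow> real"
  assumes [measurable]: "h \<in> borel_measurable (lebesgue_on cube)" and C: "\<And>x. x \<in> cube \<Longrightarrow> \<bar>h x\<bar> \<le> C"
  shows "integrable (lebesgue_on cube) (\<lambda>x. h x * cube_weight \<alpha> \<beta> x)"
proof (rule Bochner_Integration.integrable_bound)
  show "integrable (lebesgue_on cube) (\<lambda>x::real ^ 's. C * cube_weight \<alpha> \<beta> x)"
    by (intro integrable_mult_right integrable_cube_weight)
  show "(\<lambda>x. h x * cube_weight \<alpha> \<beta> x) \<in> borel_measurable (lebesgue_on cube)" by measurable
  show "AE x in lebesgue_on cube. norm (h x * cube_weight \<alpha> \<beta> x) \<le> norm (C * cube_weight \<alpha> \<beta> x)"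
  proof (rule AE_I2)
    fix x :: "real ^ 's" assume "x \<in> space (lebesgue_on cube)"
    then have "\<bar>h x\<bar> \<le> \<bar>C\<bar>" using C[of x] by simp
    then show "norm (h x * cube_weight \<alpha> \<beta> x) \<le> norm (C * cube_weight \<alpha> \<beta> x)"
      by (simp add: abs_mult mult_right_mono)
  qed
qed

lemma bounded_mem_L2:
  fixes f :: "real ^ 's \<Rightarrow> real"
  assumes [measurable]: "f \<in> borel_measurable (lebesgue_on cube)" and B: "\<And>x. x \<in> cube \<Longrightarrow> \<bar>f x\<bar> \<le> B"
  shows "f \<in> L2 \<alpha> \<beta>"
proof -
  have "\<bar>(f x)\<^sup>2\<bar> \<le> B\<^sup>2" if "x \<in> cube" for x
    using power_mono[OF B[OF that], of 2] by simp
  then show ?thesis unfolding L2_def by (auto intro!: integrable_bounded_cube_weight)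
qed

lemma continuous_mem_L2:
  fixes f :: "real ^ 's \<Rightarrow> real"
  assumes "continuous_on UNIV f"
  shows "f \<in> L2 \<alpha> \<beta>"
proof -
  have "bounded (f ` cube)"
    using assms compact_cube
    by (intro compact_imp_bounded compact_continuous_image) (auto elim: continuous_on_subset)
  then obtain B where "\<And>x. x \<in> cube \<Longrightarrow> \<bar>f x\<bar> \<le> B"
    unfolding bounded_iff by auto
  then show ?thesis using assms by (intro bounded_mem_L2 continuous_imp_measurable_cube)
qed

lemma L2_measurable: "f \<in> L2 \<alpha> \<beta> \<Longrightarrow> f \<in> borel_measurable (lebesgue_on cube)"
  by (simp add: L2_def)

lemma L2_integrable_mult:
  fixes f g :: "real ^ 's \<Rightarrow> real"
  assumes f: "f \<in> L2 \<alpha> \<beta>" and g: "g \<in> L2 \<alpha> \<beta>"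
  shows "integrable (lebesgue_on cube) (\<lambda>x. f x * g x * cube_weight \<alpha> \<beta> x)"
proof (rule Bochner_Integration.integrable_bound)
  note [measurable] = L2_measurable[OF f] L2_measurable[OF g]
  show "integrable (lebesgue_on cube) (\<lambda>x. (f x)\<^sup>2 * cube_weight \<alpha> \<beta> x + (g x)\<^sup>2 * cube_weight \<alpha> \<beta> x)"
    using f g unfolding L2_def by auto
  show "(\<lambda>x. f x * g x * cube_weight \<alpha> \<beta> x) \<in> borel_measurable (lebesgue_on cube)" by measurable
  have "\<bar>f x * g x\<bar> * cube_weight \<alpha> \<beta> x \<le> ((f x)\<^sup>2 + (g x)\<^sup>2) * cube_weight \<alpha> \<beta> x" for x
    by (intro mult_right_mono abs_mult_le_add_squares cube_weight_nonneg)
  then show "AE x in lebesgue_on cube. norm (f x * g x * cube_weight \<alpha> \<beta> x)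
      \<le> norm ((f x)\<^sup>2 * cube_weight \<alpha> \<beta> x + (g x)\<^sup>2 * cube_weight \<alpha> \<beta> x)"
    by (intro AE_I2) (simp add: abs_mult cube_weight_nonneg distrib_right)
qed

lemma subspace_L2: "subspace (L2 \<alpha> \<beta> :: (real ^ 's \<Rightarrow> real) set)"
proof (rule subspaceI)
  show "0 \<in> L2 \<alpha> \<beta>" by (simp add: L2_def zero_fun_def)
next
  fix f g :: "real ^ 's \<Rightarrow> real"
  assume fg: "f \<in> L2 \<alpha> \<beta>" "g \<in> L2 \<alpha> \<beta>"
  note [measurable] = L2_measurable[OF fg(1)] L2_measurable[OF fg(2)]
  have "integrable (lebesgue_on cube) (\<lambda>x. f x * f x * cube_weight \<alpha> \<beta> x
      + 2 * (f x * g x * cube_weight \<alpha> \<beta> x) + g x * g x * cube_weight \<alpha> \<beta> x)"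
    by (intro Bochner_Integration.integrable_add integrable_mult_right L2_integrable_mult fg)
  then show "f + g \<in> L2 \<alpha> \<beta>"
    unfolding L2_def by (auto simp: plus_fun_def power2_eq_square algebra_simps)
next
  fix f :: "real ^ 's \<Rightarrow> real" and c :: real
  assume f: "f \<in> L2 \<alpha> \<beta>"
  note [measurable] = L2_measurable[OF f]
  have "integrable (lebesgue_on cube) (\<lambda>x. c\<^sup>2 * ((f x)\<^sup>2 * cube_weight \<alpha> \<beta> x))"
    using f unfolding L2_def by auto
  then show "c *\<^sub>R f \<in> L2 \<alpha> \<beta>"
    unfolding L2_def by (auto simp: scaleR_fun_def power_mult_distrib mult.assoc)
qed

lemma L2_inner_jacobi_tensor:
  "L2_inner \<alpha> \<beta> (jacobi_tensor \<alpha> \<beta> k) (jacobi_tensor \<alpha> \<beta> l) = (if k = (l :: nat ^ 's) then 1 else 0)"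
proof -
  define f where "f j t = poly (jacobi_poly \<alpha> \<beta> (k $ j)) t * poly (jacobi_poly \<alpha> \<beta> (l $ j)) t * jacobi_weight \<alpha> \<beta> t"
    for j t
  have "L2_inner \<alpha> \<beta> (jacobi_tensor \<alpha> \<beta> k) (jacobi_tensor \<alpha> \<beta> l) =
      (LINT x|lebesgue_on cube. (\<Prod>j\<in>UNIV. f j (x $ j)))"
    by (simp add: L2_inner_def weighted_inner_def jacobi_tensor_def cube_weight_eq_prod f_def prod.distrib)
  also have "\<dots> = (\<Prod>j\<in>UNIV. LINT t|lebesgue_on {-1..1}. f j t)"
  proof (rule lebesgue_on_cube_prod(2))
    show "f j \<in> borel_measurable borel" for j unfolding f_def by measurable
    show "integrable (lebesgue_on {-1..1}) (f j)" for j
      using integrable_poly_jacobi_weight[OF ab, of "jacobi_poly \<alpha> \<beta> (k $ j) * jacobi_poly \<alpha> \<beta> (l $ j)"]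
      by (simp add: f_def[abs_def])
  qed
  also have "\<dots> = (\<Prod>j\<in>UNIV. if k $ j = l $ j then 1 else 0)"
    using orthonormal_jacobi[OF ab] by (intro prod.cong) (auto simp: f_def weighted_inner_def)
  also have "\<dots> = (if k = l then 1 else 0)"
    by (auto simp: vec_eq_iff)
  finally show ?thesis .
qed

text \<open>Dominated convergence in the form shared by two approximation steps: truncation of an
  \<open>L2\<close> function and passage from bounded to continuous functions.\<close>

lemma L2_inner_diff_lt:
  fixes s :: "nat \<Rightarrow> real ^ 's \<Rightarrow> real"
  assumes f [measurable]: "f \<in> borel_measurable (lebesgue_on cube)"
    and s [measurable]: "\<And>n. s n \<in> borel_measurable (lebesgue_on cube)"
    and h: "integrable (lebesgue_on cube) h"
    and bound: "\<And>n x. x \<in> cube \<Longrightarrow> (f x - s n x)\<^sup>2 * cube_weight \<alpha> \<beta> x \<le> h x"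
    and lim: "AE x in lebesgue_on cube. (\<lambda>n. s n x) \<longlonglongrightarrow> f x"
    and \<epsilon>: "\<epsilon> > 0"
  shows "\<exists>n. L2_inner \<alpha> \<beta> (f - s n) (f - s n) < \<epsilon>"
proof -
  have "(\<lambda>n. LINT x|lebesgue_on cube. (f x - s n x)\<^sup>2 * cube_weight \<alpha> \<beta> x) \<longlonglongrightarrow> (LINT x|lebesgue_on (cube :: (real ^ 's) set). 0)"
  proof (rule integral_dominated_convergence[OF _ _ h])
    show "AE x in lebesgue_on cube. (\<lambda>n. (f x - s n x)\<^sup>2 * cube_weight \<alpha> \<beta> x) \<longlonglongrightarrow> 0"
      using lim
    proof eventually_elim
      case (elim x)
      have "(\<lambda>n. (f x - s n x)\<^sup>2 * cube_weight \<alpha> \<beta> x) \<longlonglongrightarrow> (f x - f x)\<^sup>2 * cube_weight \<alpha> \<beta> x"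
        by (intro tendsto_intros elim)
      then show ?case by simp
    qed
    show "AE x in lebesgue_on cube. norm ((f x - s n x)\<^sup>2 * cube_weight \<alpha> \<beta> x) \<le> h x" for n
      using bound by (intro AE_I2) (simp add: cube_weight_nonneg)
  qed measurable
  then have "\<forall>\<^sub>F n in sequentially. (LINT x|lebesgue_on cube. (f x - s n x)\<^sup>2 * cube_weight \<alpha> \<beta> x) < \<epsilon>"
    using \<epsilon> by (intro order_tendstoD(2)) auto
  then show ?thesis
    by (auto simp: eventually_sequentially L2_inner_def weighted_inner_def power2_eq_square)
qed

lemma L2_approx_bounded:
  fixes f :: "real ^ 's \<Rightarrow> real"
  assumes f: "f \<in> L2 \<alpha> \<beta>" and "\<epsilon> > 0"
  obtains g B where "g \<in> borel_measurable (lebesgue_on cube)" "\<And>x. \<bar>g x\<bar> \<le> B"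
    "L2_inner \<alpha> \<beta> (f - g) (f - g) < \<epsilon>"
proof -
  note [measurable] = L2_measurable[OF f]
  \<comment> \<open>Truncation at height \<open>n\<close> is exact as soon as \<open>n\<close>
    exceeds \<open>\<bar>f x\<bar>\<close>, and its error never exceeds
    \<open>\<bar>f x\<bar>\<close>, which yields the dominating function.\<close>
  define s where "s n x = max (- real n) (min (real n) (f x))" for n x
  have s [measurable]: "s n \<in> borel_measurable (lebesgue_on cube)" for n
    unfolding s_def by measurable
  have "\<exists>n. L2_inner \<alpha> \<beta> (f - s n) (f - s n) < \<epsilon>"
  proof (rule L2_inner_diff_lt)
    show "integrable (lebesgue_on cube) (\<lambda>x. (f x)\<^sup>2 * cube_weight \<alpha> \<beta> x)"
      using f by (simp add: L2_def)
    show "(f x - s n x)\<^sup>2 * cube_weight \<alpha> \<beta> x \<le> (f x)\<^sup>2 * cube_weight \<alpha> \<beta> x" for n x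
    proof (intro mult_right_mono cube_weight_nonneg)
      have "\<bar>f x - s n x\<bar> \<le> \<bar>f x\<bar>" by (auto simp: s_def)
      then show "(f x - s n x)\<^sup>2 \<le> (f x)\<^sup>2" by (simp add: abs_le_square_iff)
    qed
    show "AE x in lebesgue_on cube. (\<lambda>n. s n x) \<longlonglongrightarrow> f x"
    proof (intro AE_I2 tendsto_eventually eventually_sequentiallyI)
      fix x n assume "nat \<lceil>\<bar>f x\<bar>\<rceil> \<le> n"
      then have "\<bar>f x\<bar> \<le> real n" by linarith
      then show "s n x = f x" by (auto simp: s_def)
    qed
  qed (use assms in auto)
  then obtain n where "L2_inner \<alpha> \<beta> (f - s n) (f - s n) < \<epsilon>" by blast
  moreover have "\<bar>s n x\<bar> \<le> real n" for x by (auto simp: s_def)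
  ultimately show ?thesis using that s by blast
qed

lemma bounded_approx_continuous:
  fixes f :: "real ^ 's \<Rightarrow> real"
  assumes f [measurable]: "f \<in> borel_measurable (lebesgue_on cube)" and B: "\<And>x. \<bar>f x\<bar> \<le> B" and "\<epsilon> > 0"
  obtains g where "continuous_on UNIV g" "L2_inner \<alpha> \<beta> (f - g) (f - g) < \<epsilon>"
proof -
  have "f measurable_on cube"
    using f by (simp add: measurable_on_iff_borel_measurable)
  then obtain M g where M: "negligible M" and g: "\<And>n. continuous_on UNIV (g n)"
    and lim: "\<And>x. x \<notin> M \<Longrightarrow> (\<lambda>n. g n x) \<longlonglongrightarrow> (if x \<in> cube then f x else 0)"
    unfolding measurable_on_def by blast
  \<comment> \<open>The continuous functions \<open>g n\<close> may be unbounded in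
    \<open>n\<close>. Clipping at the bound of \<open>f\<close> preserves the limit and makes
    \<open>(2 * B)\<^sup>2\<close> times the weight a dominating function.\<close>
  define s where "s n x = max (- B) (min B (g n x))" for n x
  have s: "continuous_on UNIV (s n)" for n
    unfolding s_def by (intro continuous_intros g)
  have "\<exists>n. L2_inner \<alpha> \<beta> (f - s n) (f - s n) < \<epsilon>"
  proof (rule L2_inner_diff_lt)
    show "s n \<in> borel_measurable (lebesgue_on cube)" for n
      using s by (rule continuous_imp_measurable_cube)
    show "integrable (lebesgue_on cube) (\<lambda>x::real ^ 's. (2 * B)\<^sup>2 * cube_weight \<alpha> \<beta> x)"
      by (intro integrable_mult_right integrable_cube_weight)
    show "(f x - s n x)\<^sup>2 * cube_weight \<alpha> \<beta> x \<le> (2 * B)\<^sup>2 * cube_weight \<alpha> \<beta> x" for n x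
    proof (intro mult_right_mono cube_weight_nonneg)
      have "\<bar>f x - s n x\<bar> \<le> \<bar>2 * B\<bar>" using B[of x] by (auto simp: s_def)
      then show "(f x - s n x)\<^sup>2 \<le> (2 * B)\<^sup>2" by (simp only: abs_le_square_iff)
    qed
    have "AE x in lebesgue. x \<notin> M"
      using M by (simp add: negligible_iff_null_sets AE_not_in)
    then have "AE x in lebesgue_on cube. x \<notin> M"
      by (subst AE_restrict_space_iff) auto
    moreover have "AE x in lebesgue_on cube. x \<in> (cube :: (real ^ 's) set)" by (rule AE_I2) simp
    ultimately show "AE x in lebesgue_on cube. (\<lambda>n. s n x) \<longlonglongrightarrow> f x"
    proof eventually_elim
      case (elim x)
      then have "(\<lambda>n. g n x) \<longlonglongrightarrow> f x" using lim[of x] by simp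
      then have "(\<lambda>n. s n x) \<longlonglongrightarrow> max (- B) (min B (f x))"
        unfolding s_def by (intro tendsto_intros)
      also have "max (- B) (min B (f x)) = f x" using B[of x] by auto
      finally show ?case .
    qed
  qed (use assms in auto)
  then show ?thesis using that s by blast
qed

lemma continuous_approx_polynomial:
  fixes f :: "real ^ 's \<Rightarrow> real"
  assumes f: "continuous_on UNIV f" and \<epsilon>: "\<epsilon> > 0"
  obtains p where "real_polynomial_function p" "L2_inner \<alpha> \<beta> (f - p) (f - p) < \<epsilon>"
proof -
  define W where "W = (LINT x|lebesgue_on (cube :: (real ^ 's) set). cube_weight \<alpha> \<beta> x)"
  have W: "W \<ge> 0" unfolding W_def by (simp add: cube_weight_nonneg)
  \<comment> \<open>A uniform error \<open>\<delta>\<close> costs at most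
    \<open>\<delta>\<^sup>2 * W = \<epsilon> * W / (W + 1) < \<epsilon>\<close>; the summand 1 keeps
    the denominator positive.\<close>
  define \<delta> where "\<delta> = sqrt (\<epsilon> / (W + 1))"
  have \<delta>: "\<delta> > 0" using W \<epsilon> by (simp add: \<delta>_def)
  obtain p where p: "real_polynomial_function p" "\<And>x. x \<in> cube \<Longrightarrow> \<bar>f x - p x\<bar> < \<delta>"
    using Stone_Weierstrass_real_polynomial_function[OF compact_cube continuous_on_subset[OF f subset_UNIV] \<delta>] by metis
  have cont: "continuous_on UNIV (f - p)"
    using f p(1) continuous_on_polymonial_function[of p]
    by (simp add: fun_diff_def continuous_on_diff real_polynomial_function_eq)
  have "L2_inner \<alpha> \<beta> (f - p) (f - p) \<le> (LINT x|lebesgue_on (cube :: (real ^ 's) set). \<delta>\<^sup>2 * cube_weight \<alpha> \<beta> x)"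
    unfolding L2_inner_def weighted_inner_def
  proof (rule integral_mono)
    show "integrable (lebesgue_on cube) (\<lambda>x. (f - p) x * (f - p) x * cube_weight \<alpha> \<beta> x)"
      by (intro L2_integrable_mult continuous_mem_L2 cont)
    fix x :: "real ^ 's" assume "x \<in> space (lebesgue_on cube)"
    then have "\<bar>f x - p x\<bar> \<le> \<bar>\<delta>\<bar>" using p(2)[of x] by simp
    then have "(f x - p x)\<^sup>2 \<le> \<delta>\<^sup>2" by (simp only: abs_le_square_iff)
    then show "(f - p) x * (f - p) x * cube_weight \<alpha> \<beta> x \<le> \<delta>\<^sup>2 * cube_weight \<alpha> \<beta> x"
      by (intro mult_right_mono cube_weight_nonneg) (simp add: power2_eq_square)
  qed (intro integrable_mult_right integrable_cube_weight)
  also have "\<dots> = \<epsilon> / (W + 1) * W" using \<epsilon> W by (simp add: W_def[symmetric] \<delta>_def)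
  also have "\<dots> < \<epsilon>" using \<epsilon> W by (simp add: field_simps)
  finally show ?thesis using that p(1) by blast
qed

text \<open>The Jacobi polynomial of index \<open>m\<close> has degree exactly \<open>m\<close>, so
  subtracting a multiple of the top one lowers the degree.\<close>

lemma poly_jacobi_expansion:
  "degree q \<le> n \<Longrightarrow> \<exists>c. q = (\<Sum>m\<le>n. smult (c m) (jacobi_poly \<alpha> \<beta> m))"
proof (induction n arbitrary: q)
  case 0
  define P where "P = jacobi_poly \<alpha> \<beta> 0"
  have P: "degree P = 0" "coeff P 0 \<noteq> 0"
    using degree_jacobi_poly[OF ab, of 0] lead_coeff_jacobi_poly[OF ab, of 0] by (auto simp: P_def)
  obtain p0 q0 where "P = [:p0:]" "q = [:q0:]"
    using P 0 by (metis degree_eq_zeroE le_zero_eq)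
  with P have "q = smult (q0 / p0) P" by simp
  then show ?case by (auto simp: P_def)
next
  case (Suc n)
  define P where "P = jacobi_poly \<alpha> \<beta> (Suc n)"
  have P: "degree P = Suc n" "coeff P (Suc n) \<noteq> 0"
    using degree_jacobi_poly[OF ab, of "Suc n"] lead_coeff_jacobi_poly[OF ab, of "Suc n"] by (auto simp: P_def)
  define d where "d = coeff q (Suc n) / coeff P (Suc n)"
  have "degree (q - smult d P) \<le> n"
  proof (rule degree_le, intro allI impI)
    fix i assume "n < i"
    then consider "i = Suc n" | "i > Suc n" by linarith
    then show "coeff (q - smult d P) i = 0"
      by cases (use P Suc.prems in \<open>auto simp: d_def coeff_eq_0\<close>)
  qed
  from Suc.IH[OF this] obtain c where c: "q - smult d P = (\<Sum>m\<le>n. smult (c m) (jacobi_poly \<alpha> \<beta> m))" by blast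
  have "q = (\<Sum>m\<le>n. smult (c m) (jacobi_poly \<alpha> \<beta> m)) + smult d P"
    unfolding c[symmetric] by simp
  also have "\<dots> = (\<Sum>m\<le>Suc n. smult ((c(Suc n := d)) m) (jacobi_poly \<alpha> \<beta> m))"
    by (simp add: P_def)
  finally show ?case by blast
qed

text \<open>Only the factor in \<open>x $ j\<close> changes: its product with the variable is
  expanded in Jacobi polynomials up to one degree higher, while the other factors \<open>R\<close>
  are carried along.\<close>

lemma coordinate_mult_jacobi_tensor:
  "(\<lambda>x. x $ j * jacobi_tensor \<alpha> \<beta> k x) \<in> span (range (jacobi_tensor \<alpha> \<beta>))"
proof -
  define n where "n = k $ j"
  define k' where "k' m = (\<chi> i. if i = j then m else k $ i)" for m
  have "degree (pCons 0 (jacobi_poly \<alpha> \<beta> n)) \<le> Suc n"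
    using degree_jacobi_poly[OF ab, of n] by (simp add: degree_pCons_eq_if)
  then obtain c where c: "pCons 0 (jacobi_poly \<alpha> \<beta> n) = (\<Sum>m\<le>Suc n. smult (c m) (jacobi_poly \<alpha> \<beta> m))"
    using poly_jacobi_expansion by blast
  define R where "R x = (\<Prod>i\<in>UNIV - {j}. poly (jacobi_poly \<alpha> \<beta> (k $ i)) (x $ i))" for x
  have k': "jacobi_tensor \<alpha> \<beta> (k' m) x = poly (jacobi_poly \<alpha> \<beta> m) (x $ j) * R x" for m x
    unfolding jacobi_tensor_def R_def
    by (subst prod.remove[of _ j]) (auto simp: k'_def intro!: prod.cong)
  have "k' n = k" by (simp add: k'_def n_def vec_eq_iff)
  then have "x $ j * jacobi_tensor \<alpha> \<beta> k x = poly (pCons 0 (jacobi_poly \<alpha> \<beta> n)) (x $ j) * R x" for x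
    using k'[of n x] by simp
  also have "poly (pCons 0 (jacobi_poly \<alpha> \<beta> n)) (x $ j) * R x = (\<Sum>m\<le>Suc n. c m * jacobi_tensor \<alpha> \<beta> (k' m) x)" for x
    unfolding c by (simp add: poly_sum k' sum_distrib_right mult.assoc del: sum.atMost_Suc)
  finally have "(\<lambda>x. x $ j * jacobi_tensor \<alpha> \<beta> k x) = (\<Sum>m\<le>Suc n. c m *\<^sub>R jacobi_tensor \<alpha> \<beta> (k' m))"
    by (simp add: fun_eq_iff sum_fun_apply del: sum.atMost_Suc)
  then show ?thesis
    by (simp only:) (intro span_sum span_scale span_base rangeI)
qed

lemma coordinate_mult_span_jacobi_tensor:
  assumes "q \<in> span (range (jacobi_tensor \<alpha> \<beta>))"
  shows "(\<lambda>x. x $ j * q x) \<in> span (range (jacobi_tensor \<alpha> \<beta>))"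
  using assms
proof (induction rule: span_induct_alt)
  case base
  have "(\<lambda>x::real ^ 'a. x $ j * (0 :: real ^ 'a \<Rightarrow> real) x) = 0" by (simp add: fun_eq_iff)
  then show ?case using span_zero by simp
next
  case (step c f q)
  then obtain k where k: "f = jacobi_tensor \<alpha> \<beta> k" by blast
  have "(\<lambda>x. x $ j * (c *\<^sub>R f + q) x) = c *\<^sub>R (\<lambda>x. x $ j * jacobi_tensor \<alpha> \<beta> k x) + (\<lambda>x. x $ j * q x)"
    by (simp add: fun_eq_iff k algebra_simps)
  also have "\<dots> \<in> span (range (jacobi_tensor \<alpha> \<beta>))"
    by (intro span_add span_scale coordinate_mult_jacobi_tensor step)
  finally show ?case .
qed

text \<open>Membership of \<open>p\<close> alone would not survive the product case of the
  induction, because it says nothing about products of span elements. Stated as invariance of the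
  span under multiplication by \<open>p\<close>, the product case is two successive
  applications.\<close>

lemma polynomial_mult_span_jacobi_tensor:
  fixes p :: "real ^ 's \<Rightarrow> real"
  assumes "real_polynomial_function p" "q \<in> span (range (jacobi_tensor \<alpha> \<beta>))"
  shows "(\<lambda>x. p x * q x) \<in> span (range (jacobi_tensor \<alpha> \<beta>))"
  using assms
proof (induction arbitrary: q rule: real_polynomial_function.induct)
  case (linear f)
  interpret f: bounded_linear f by fact
  have f_eq: "f x = (\<Sum>j\<in>UNIV. x $ j * f (axis j 1))" for x
  proof -
    have "f x = f (\<Sum>j\<in>UNIV. x $ j *\<^sub>R axis j 1)"
      using basis_expansion[of x] by (simp add: scalar_mult_eq_scaleR)
    then show ?thesis by (simp add: f.sum f.scaleR)
  qed
  have "(\<lambda>x. f x * q x) = (\<Sum>j\<in>UNIV. f (axis j 1) *\<^sub>R (\<lambda>x. x $ j * q x))"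
    by (subst f_eq) (simp add: fun_eq_iff sum_fun_apply sum_distrib_left mult_ac)
  also have "\<dots> \<in> span (range (jacobi_tensor \<alpha> \<beta>))"
    by (intro span_sum span_scale coordinate_mult_span_jacobi_tensor linear)
  finally show ?case .
next
  case (const c)
  have "(\<lambda>x. c * q x) = c *\<^sub>R q" by (simp add: fun_eq_iff)
  then show ?case using span_scale[OF const, of c] by (simp only:)
next
  case (add f g)
  have "(\<lambda>x. (f x + g x) * q x) = (\<lambda>x. f x * q x) + (\<lambda>x. g x * q x)"
    by (simp add: fun_eq_iff distrib_right)
  then show ?case using span_add[OF add.IH[OF add.prems]] by (simp only:)
next
  case (mult f g)
  show ?case unfolding mult.assoc by (intro mult.IH mult.prems)
qed

text \<open>The tensor with index 0 is a nonzero constant, so \<open>p\<close> is a scalar multiple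
  of \<open>p\<close> times an element of the span.\<close>

lemma polynomial_mem_span_jacobi_tensor:
  fixes p :: "real ^ 's \<Rightarrow> real"
  assumes "real_polynomial_function p"
  shows "p \<in> span (range (jacobi_tensor \<alpha> \<beta>))"
proof -
  define P where "P = jacobi_poly \<alpha> \<beta> 0"
  define c where "c = coeff P 0 ^ CARD('s)"
  have P: "degree P = 0" "coeff P 0 \<noteq> 0"
    using degree_jacobi_poly[OF ab, of 0] lead_coeff_jacobi_poly[OF ab, of 0] by (auto simp: P_def)
  obtain p0 where "P = [:p0:]" using P(1) by (rule degree_eq_zeroE)
  then have "poly P t = coeff P 0" for t by simp
  then have "jacobi_tensor \<alpha> \<beta> 0 x = c" for x :: "real ^ 's"
    by (simp add: jacobi_tensor_def c_def P_def)
  then have "p = (1 / c) *\<^sub>R (\<lambda>x. p x * jacobi_tensor \<alpha> \<beta> 0 x)"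
    using P(2) by (simp add: fun_eq_iff c_def)
  also have "\<dots> \<in> span (range (jacobi_tensor \<alpha> \<beta>))"
    by (intro span_scale polynomial_mult_span_jacobi_tensor assms span_base rangeI)
  finally show ?thesis .
qed

end

section \<open>Widths of the ball and asymptotics\<close>

lemma lam_pos: "a > 0 \<Longrightarrow> lam a k > 0"
  by (auto simp: lam_def intro!: prod_pos add_pos_nonneg)

lemma bij_betw_lam_le_hyp_cross:
  "bij_betw ($) {k :: nat ^ 's. lam a k \<le> T} (hyp_cross a UNIV T)"
proof (rule bij_betwI[where g = vec_lambda])
  show "($) \<in> {k :: nat ^ 's. lam a k \<le> T} \<rightarrow> hyp_cross a UNIV T"
    by (auto simp: hyp_cross_def lam_def)
  show "vec_lambda \<in> hyp_cross a UNIV T \<rightarrow> {k :: nat ^ 's. lam a k \<le> T}"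
    by (auto simp: hyp_cross_def lam_def)
qed (simp_all add: vec_lambda_inverse)

lemma card_lam_le: "card {k :: nat ^ 's. lam a k \<le> T} = card (hyp_cross a (UNIV :: 's set) T)"
  using bij_betw_same_card[OF bij_betw_lam_le_hyp_cross] .

lemma finite_lam_le: "a > 0 \<Longrightarrow> finite {k :: nat ^ 's. lam a k \<le> T}"
  using bij_betw_finite[OF bij_betw_lam_le_hyp_cross] finite_hyp_cross[OF _ finite] by blast

lemma orthonormal_family_jacobi_tensor:
  assumes "\<alpha> > -1" "\<beta> > -1"
  shows "orthonormal_family (L2 \<alpha> \<beta>) (L2_inner \<alpha> \<beta>) (jacobi_tensor \<alpha> \<beta> :: nat ^ 's \<Rightarrow> _)"
proof unfold_locales
  note int = L2_integrable_mult[OF assms]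
  show "subspace (L2 \<alpha> \<beta> :: (real ^ 's \<Rightarrow> real) set)"
    by (rule subspace_L2[OF assms])
  show "L2_inner \<alpha> \<beta> f g = L2_inner \<alpha> \<beta> g f" for f g :: "real ^ 's \<Rightarrow> real"
    by (simp add: L2_inner_def weighted_inner_def mult.commute)
  show "L2_inner \<alpha> \<beta> (f + g) h = L2_inner \<alpha> \<beta> f h + L2_inner \<alpha> \<beta> g h"
    if "f \<in> L2 \<alpha> \<beta>" "g \<in> L2 \<alpha> \<beta>" "h \<in> L2 \<alpha> \<beta>" for f g h :: "real ^ 's \<Rightarrow> real"
    using int[OF that(1,3)] int[OF that(2,3)]
    by (simp add: L2_inner_def weighted_inner_def distrib_right)
  show "L2_inner \<alpha> \<beta> (c *\<^sub>R f) h = c * L2_inner \<alpha> \<beta> f h" for c and f h :: "real ^ 's \<Rightarrow> real"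
    by (simp add: L2_inner_def weighted_inner_def mult.assoc)
  show "0 \<le> L2_inner \<alpha> \<beta> f f" for f :: "real ^ 's \<Rightarrow> real"
    by (simp add: L2_inner_def weighted_inner_def cube_weight_nonneg)
  show "jacobi_tensor \<alpha> \<beta> k \<in> L2 \<alpha> \<beta>" for k :: "nat ^ 's"
    by (intro continuous_mem_L2[OF assms] continuous_on_jacobi_tensor)
  show "L2_inner \<alpha> \<beta> (jacobi_tensor \<alpha> \<beta> j) (jacobi_tensor \<alpha> \<beta> k) = (if j = k then 1 else 0)" for j k :: "nat ^ 's"
    by (rule L2_inner_jacobi_tensor[OF assms])
qed

lemma dense_span_jacobi_tensor:
  fixes f :: "real ^ 's \<Rightarrow> real"
  assumes ab: "\<alpha> > -1" "\<beta> > -1" and f: "f \<in> L2 \<alpha> \<beta>" and \<epsilon>: "\<epsilon> > 0"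
  shows "\<exists>p \<in> span (range (jacobi_tensor \<alpha> \<beta>)). L2_inner \<alpha> \<beta> (f - p) (f - p) < \<epsilon>"
proof -
  interpret orthonormal_family "L2 \<alpha> \<beta>" "L2_inner \<alpha> \<beta>" "jacobi_tensor \<alpha> \<beta> :: nat ^ 's \<Rightarrow> _"
    using ab by (rule orthonormal_family_jacobi_tensor)
  \<comment> \<open>Two uses of the doubled triangle inequality weight the three errors by 2, 4 and
    4, which add up to 10.\<close>
  have \<epsilon>': "\<epsilon> / 10 > 0" using \<epsilon> by simp
  obtain g B where g: "g \<in> borel_measurable (lebesgue_on cube)" "\<And>x. \<bar>g x\<bar> \<le> B"
    "L2_inner \<alpha> \<beta> (f - g) (f - g) < \<epsilon> / 10"
    using L2_approx_bounded[OF ab f \<epsilon>'] by blast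
  obtain h where h: "continuous_on UNIV h" "L2_inner \<alpha> \<beta> (g - h) (g - h) < \<epsilon> / 10"
    using bounded_approx_continuous[OF ab g(1,2) \<epsilon>'] by blast
  obtain p where p: "real_polynomial_function p" "L2_inner \<alpha> \<beta> (h - p) (h - p) < \<epsilon> / 10"
    using continuous_approx_polynomial[OF ab h(1) \<epsilon>'] by blast
  have gX: "g \<in> L2 \<alpha> \<beta>" using g(1,2) by (intro bounded_mem_L2[OF ab]) auto
  have hX: "h \<in> L2 \<alpha> \<beta>" using h(1) by (rule continuous_mem_L2[OF ab])
  have pX: "p \<in> L2 \<alpha> \<beta>"
    using p(1) by (intro continuous_mem_L2[OF ab] continuous_on_polymonial_function) (simp add: real_polynomial_function_eq)
  note [simp] = carrier_diff gX hX pX f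
  have "L2_inner \<alpha> \<beta> (g - p) (g - p) \<le> 2 * L2_inner \<alpha> \<beta> (g - h) (g - h) + 2 * L2_inner \<alpha> \<beta> (h - p) (h - p)"
    using ip_add_add_le[of "g - h" "h - p"] by simp
  moreover have "L2_inner \<alpha> \<beta> (f - p) (f - p) \<le> 2 * L2_inner \<alpha> \<beta> (f - g) (f - g) + 2 * L2_inner \<alpha> \<beta> (g - p) (g - p)"
    using ip_add_add_le[of "f - g" "g - p"] by simp
  ultimately have "L2_inner \<alpha> \<beta> (f - p) (f - p) < \<epsilon>"
    using g(3) h(2) p(2) by linarith
  then show ?thesis using polynomial_mem_span_jacobi_tensor[OF ab p(1)] by blast
qed

context
  fixes \<alpha> \<beta> a r T :: real
  assumes ab: "\<alpha> > -1" "\<beta> > -1" and a: "a > 0" and r: "r > 0" and T: "T > 0"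
begin

lemma L2_norm_eq: "L2_norm \<alpha> \<beta> = (\<lambda>f. sqrt (L2_inner \<alpha> \<beta> f f))"
  by (simp add: fun_eq_iff L2_norm_def)

text \<open>Outside the cross the weight \<open>lam a k powr (2 * r)\<close> is at least
  \<open>T powr (2 * r)\<close>, so the unit bound on the weighted sum leaves at most
  \<open>T powr (- 2 * r)\<close> for the squared tail.\<close>

lemma kolmogorov_width_K_ball_le:
  assumes "card {k :: nat ^ 's. lam a k \<le> T} \<le> N"
  shows "kolmogorov_width N (K_ball r a \<alpha> \<beta> :: (real ^ 's \<Rightarrow> real) set) (L2 \<alpha> \<beta>) (L2_norm \<alpha> \<beta>)
    \<le> ereal (T powr - r)"
proof -
  interpret orthonormal_family "L2 \<alpha> \<beta>" "L2_inner \<alpha> \<beta>" "jacobi_tensor \<alpha> \<beta> :: nat ^ 's \<Rightarrow> _"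
    using ab by (rule orthonormal_family_jacobi_tensor)
  show ?thesis
    unfolding L2_norm_eq
  proof (rule kolmogorov_width_le[OF _ finite_lam_le[OF a] assms])
    show "\<exists>g\<in>span (range (jacobi_tensor \<alpha> \<beta>)). L2_inner \<alpha> \<beta> (f - g) (f - g) < \<epsilon>"
      if "f \<in> L2 \<alpha> \<beta>" "\<epsilon> > 0" for f :: "real ^ 's \<Rightarrow> real" and \<epsilon>
      using dense_span_jacobi_tensor[OF ab that] .
    show "K_ball r a \<alpha> \<beta> \<subseteq> L2 \<alpha> \<beta>" by (auto simp: K_ball_def K_space_def)
    fix f :: "real ^ 's \<Rightarrow> real" and F :: "(nat ^ 's) set"
    assume f: "f \<in> K_ball r a \<alpha> \<beta>" and F: "finite F" "F \<inter> {k. lam a k \<le> T} = {}"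
    define c where "c k = L2_inner \<alpha> \<beta> f (jacobi_tensor \<alpha> \<beta> k)" for k
    have sum: "(\<lambda>k. lam a k powr (2 * r) * (c k)\<^sup>2) summable_on UNIV"
      and le: "(\<Sum>\<^sub>\<infinity>k. lam a k powr (2 * r) * (c k)\<^sup>2) \<le> 1"
      using f by (auto simp: K_ball_def K_space_def K_norm_def jacobi_coeff_def c_def)
    have "T powr (2 * r) * (\<Sum>k\<in>F. (c k)\<^sup>2) \<le> (\<Sum>k\<in>F. lam a k powr (2 * r) * (c k)\<^sup>2)"
      unfolding sum_distrib_left
    proof (intro sum_mono mult_right_mono powr_mono2)
      fix k assume "k \<in> F"
      then have "lam a k > T" using F(2) by force
      then show "T \<le> lam a k" by simp
    qed (use T r in auto)
    also have "\<dots> \<le> (\<Sum>\<^sub>\<infinity>k. lam a k powr (2 * r) * (c k)\<^sup>2)"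
      by (rule finite_sum_le_infsum[OF sum F(1)]) auto
    finally have "T powr (2 * r) * (\<Sum>k\<in>F. (c k)\<^sup>2) \<le> 1" using le by linarith
    then have "(\<Sum>k\<in>F. (c k)\<^sup>2) \<le> 1 / T powr (2 * r)"
      using T by (simp add: field_simps)
    also have "\<dots> = (T powr - r)\<^sup>2"
      using T by (simp add: powr_minus power_inverse divide_inverse mult.commute flip: powr_powr powr_numeral)
    finally show "(\<Sum>k\<in>F. (L2_inner \<alpha> \<beta> f (jacobi_tensor \<alpha> \<beta> k))\<^sup>2) \<le> (T powr - r)\<^sup>2"
      by (simp add: c_def)
  qed simp
qed

text \<open>On the cross the weight is at most \<open>T powr (2 * r)\<close>, so the ball contains
  every combination of these basis functions of norm \<open>T powr - r\<close>: a sphere of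
  dimension \<open>card G > N\<close>, counted by its linear span.\<close>

lemma kolmogorov_width_K_ball_ge:
  assumes "N < card {k :: nat ^ 's. lam a k \<le> T}"
  shows "ereal (T powr - r)
    \<le> kolmogorov_width N (K_ball r a \<alpha> \<beta> :: (real ^ 's \<Rightarrow> real) set) (L2 \<alpha> \<beta>) (L2_norm \<alpha> \<beta>)"
proof -
  interpret orthonormal_family "L2 \<alpha> \<beta>" "L2_inner \<alpha> \<beta>" "jacobi_tensor \<alpha> \<beta> :: nat ^ 's \<Rightarrow> _"
    using ab by (rule orthonormal_family_jacobi_tensor)
  define G where "G = {k :: nat ^ 's. lam a k \<le> T}"
  have G: "finite G" unfolding G_def by (rule finite_lam_le[OF a])
  show ?thesis
    unfolding L2_norm_eq
  proof (rule kolmogorov_width_ge[OF G])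
    show "N < card G" using assms by (simp add: G_def)
    fix c :: "nat ^ 's \<Rightarrow> real" assume c: "(\<Sum>k\<in>G. (c k)\<^sup>2) = (T powr - r)\<^sup>2"
    define f where "f = (\<Sum>k\<in>G. c k *\<^sub>R jacobi_tensor \<alpha> \<beta> k)"
    have coeff: "jacobi_coeff \<alpha> \<beta> f k = (if k \<in> G then c k else 0)" for k
      unfolding jacobi_coeff_def f_def by (rule ip_comb_basis[OF G])
    have has_sum: "((\<lambda>k. lam a k powr (2 * r) * \<bar>jacobi_coeff \<alpha> \<beta> f k\<bar>\<^sup>2) has_sum
        (\<Sum>k\<in>G. lam a k powr (2 * r) * (c k)\<^sup>2)) UNIV"
    proof -
      have "((\<lambda>k. lam a k powr (2 * r) * (c k)\<^sup>2) has_sum (\<Sum>k\<in>G. lam a k powr (2 * r) * (c k)\<^sup>2)) G"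
        using G by (rule has_sum_finite)
      then show ?thesis
        by (subst has_sum_cong_neutral[where T = G]) (auto simp: coeff)
    qed
    have "(\<Sum>k\<in>G. lam a k powr (2 * r) * (c k)\<^sup>2) \<le> (\<Sum>k\<in>G. T powr (2 * r) * (c k)\<^sup>2)"
      using r less_imp_le[OF lam_pos[OF a]] by (intro sum_mono mult_right_mono powr_mono2) (auto simp: G_def)
    also have "\<dots> = T powr (2 * r) * (T powr - r)\<^sup>2"
      by (simp add: c flip: sum_distrib_left)
    also have "\<dots> = 1"
      using T by (simp add: power2_eq_square flip: powr_add)
    finally have le: "(\<Sum>k\<in>G. lam a k powr (2 * r) * (c k)\<^sup>2) \<le> 1" .
    have "f \<in> L2 \<alpha> \<beta>" unfolding f_def by (rule comb_mem)
    then have "f \<in> K_ball r a \<alpha> \<beta>"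
      using has_sum le by (auto simp: K_ball_def K_space_def K_norm_def has_sum_imp_summable infsumI)
    then show "(\<Sum>k\<in>G. c k *\<^sub>R jacobi_tensor \<alpha> \<beta> k) \<in> K_ball r a \<alpha> \<beta>"
      by (simp add: f_def)
  qed simp
qed

end

section \<open>Choice of the cross parameter for large N\<close>

lemma filterlim_ln_linear_at_top:
  fixes c b :: real
  assumes "c > 0" "b > 0"
  shows "filterlim (\<lambda>N. ln (real N * c / b)) at_top sequentially"
proof (rule filterlim_compose[OF ln_at_top])
  have "filterlim (\<lambda>N. c / b * real N) at_top sequentially"
    using assms by (intro filterlim_tendsto_pos_mult_at_top[OF tendsto_const] filterlim_real_sequentially) simp
  then show "filterlim (\<lambda>N. real N * c / b) at_top sequentially"
    by (simp add: mult_ac)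
qed

text \<open>For the chosen parameter the base in the upper count is
  \<open>L + \<kappa> - n * ln L\<close>, hence at most \<open>L\<close> once
  \<open>L \<ge> 1\<close> and \<open>ln L \<ge> \<kappa>\<close>. Since \<open>a > 1/2\<close>
  gives \<open>max 1 (1 / a) \<le> 2\<close>, the powers of \<open>L\<close> cancel and
  \<open>N\<close> remains.\<close>

lemma eventually_hyp_cross_le:
  fixes a :: real
  assumes a: "a > 1/2" and n: "n \<ge> 1" and A: "finite A" "card A = Suc n"
  shows "\<forall>\<^sub>F N in sequentially.
    let L = ln (real N * fact n / (a - 1/2) ^ Suc n) in
      L > 0 \<and> card (hyp_cross a A (real N * fact n / (2 * L ^ n))) \<le> N"
proof -
  define b where "b = a - 1/2"
  have b: "b > 0" using a by (simp add: b_def)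
  have a0: "a > 0" using a by simp
  define L where "L N = ln (real N * fact n / b ^ Suc n)" for N
  have lim: "filterlim L at_top sequentially"
    unfolding L_def[abs_def] using b by (intro filterlim_ln_linear_at_top) auto
  \<comment> \<open>All constants of the base, including the passage from \<open>ln a\<close> to
    \<open>ln b\<close> in the normalisation of \<open>L\<close>.\<close>
  define \<kappa> where "\<kappa> = real n / a - ln 2 - real (Suc n) * ln a + real (Suc n) * ln b"
  have "\<forall>\<^sub>F N in sequentially. L N \<ge> max 1 (exp \<kappa>)"
    using lim unfolding filterlim_at_top by blast
  then have "\<forall>\<^sub>F N in sequentially. L N > 0 \<and> card (hyp_cross a A (real N * fact n / (2 * L N ^ n))) \<le> N"
    using eventually_gt_at_top[of 0]
  proof eventually_elim
    case (elim N)
    define T where "T = real N * fact n / (2 * L N ^ n)"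
    have L: "L N \<ge> 1" "L N \<ge> exp \<kappa>" using elim by auto
    have T0: "T > 0" using L elim by (simp add: T_def)
    have lnT: "ln T = ln (real N * fact n) - ln 2 - real n * ln (L N)"
      using L elim by (simp add: T_def ln_div ln_mult_pos ln_realpow)
    have L_eq: "L N = ln (real N * fact n) - real (Suc n) * ln b"
      using elim b unfolding L_def by (subst ln_div) (auto simp: ln_realpow simp del: power_Suc)
    have "card (hyp_cross a A T) \<le> N"
    proof (cases "T \<ge> a ^ Suc n")
      case True
      define D where "D = real n / a + ln T - real (Suc n) * ln a"
      have "real (Suc n) * ln a \<le> ln T"
        using True a0 T0 by (metis ln_mono ln_realpow zero_less_power)
      moreover have "real n / a \<ge> 0" using a0 by simp
      ultimately have D0: "D \<ge> 0" unfolding D_def by linarith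
      have "\<kappa> \<le> ln (L N)" using L by (metis exp_gt_zero ln_exp ln_mono)
      also have "\<dots> \<le> real n * ln (L N)"
        using n L by (intro mult_right_mono[of 1 "real n", simplified]) auto
      finally have D: "D \<le> L N"
        unfolding D_def lnT \<kappa>_def by (subst L_eq) linarith
      have "real (card (hyp_cross a A T)) \<le> max 1 (1 / a) * T * D ^ n / fact n"
        unfolding D_def by (rule card_hyp_cross_le[OF a0 A True])
      also have "\<dots> \<le> 2 * T * L N ^ n / fact n"
        using T0 D D0 a a0 by (intro divide_right_mono mult_mono power_mono) (auto simp: field_simps)
      also have "\<dots> = real N" using L by (simp add: T_def)
      finally show ?thesis by simp
    next
      case False
      then show ?thesis using A by (simp add: hyp_cross_eq_empty[OF a0])
    qed
    then show ?case using L by (simp add: T_def)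
  qed
  then show ?thesis by (simp add: L_def b_def Let_def)
qed

lemma eventually_hyp_cross_gt:
  fixes a :: real
  assumes a: "a > 0" and n: "n \<ge> 1" and A: "finite A" "card A = Suc n"
  shows "\<forall>\<^sub>F N in sequentially.
    let L = ln (real N * fact n / a ^ Suc n) in
      L > 0 \<and> N < card (hyp_cross a A (real N * fact n * (real n + 3) / L ^ n))"
proof -
  define L where "L N = ln (real N * fact n / a ^ Suc n)" for N
  have lim: "filterlim L at_top sequentially"
    unfolding L_def[abs_def] using a by (intro filterlim_ln_linear_at_top) auto
  \<comment> \<open>The base in the lower count, as a function of \<open>x = L N\<close>; its ratio
    to \<open>x\<close> tends to 1.\<close>
  define E where "E x = x + (ln (real n + 3) - ln 2) - real n * ln x" for x
  have "((\<lambda>x. 1 + (ln (real n + 3) - ln 2) * inverse x - real n * (ln x / x)) \<longlongrightarrow>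
      1 + (ln (real n + 3) - ln 2) * 0 - real n * 0) at_top"
    by (intro tendsto_intros ln_x_over_x_tendsto_0 tendsto_inverse_0_at_top filterlim_ident)
  moreover have "\<forall>\<^sub>F x in at_top. 1 + (ln (real n + 3) - ln 2) * inverse x - real n * (ln x / x) = E x / x"
    using eventually_gt_at_top[of 0] by eventually_elim (simp add: E_def field_simps)
  ultimately have "((\<lambda>x. E x / x) \<longlongrightarrow> 1 + (ln (real n + 3) - ln 2) * 0 - real n * 0) at_top"
    by (rule Lim_transform_eventually)
  then have E_lim: "((\<lambda>x. (E x / x) ^ n) \<longlongrightarrow> 1) at_top" "((\<lambda>x. E x / x) \<longlongrightarrow> 1) at_top"
    using tendsto_power[of "\<lambda>x. E x / x" 1 at_top n] by auto
  \<comment> \<open>Since \<open>n \<ge> 1\<close> gives \<open>(n + 3) / 2 \<ge> 2\<close>, any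
    limit bound above 1/2 suffices; 3/4 leaves a factor 3/2 over \<open>N\<close>.\<close>
  have "\<forall>\<^sub>F x in at_top. (E x / x) ^ n > 3/4 \<and> E x / x > 0 \<and> x > 0"
    using order_tendstoD(1)[OF E_lim(1), of "3/4"] order_tendstoD(1)[OF E_lim(2), of 0] eventually_gt_at_top[of 0]
    by (simp add: eventually_conj_iff)
  then have "\<forall>\<^sub>F N in sequentially. (E (L N) / L N) ^ n > 3/4 \<and> E (L N) / L N > 0 \<and> L N > 0"
    using lim unfolding filterlim_iff by blast
  then have "\<forall>\<^sub>F N in sequentially. L N > 0 \<and> N < card (hyp_cross a A (real N * fact n * (real n + 3) / L N ^ n))"
    using eventually_gt_at_top[of 2]
  proof eventually_elim
    case (elim N)
    define T where "T = real N * fact n * (real n + 3) / L N ^ n"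
    have L: "L N > 0" and E0: "E (L N) > 0" and Ep: "(E (L N) / L N) ^ n > 3/4"
      using elim by (auto simp: zero_less_divide_iff)
    have T0: "T > 0" using L elim by (simp add: T_def)
    have lnT: "ln T = ln (real N * fact n) + ln (real n + 3) - real n * ln (L N)"
      using L elim by (simp add: T_def ln_div ln_mult_pos ln_realpow)
    have L_eq: "L N = ln (real N * fact n) - real (Suc n) * ln a"
      using elim a unfolding L_def by (subst ln_div) (auto simp: ln_realpow simp del: power_Suc)
    have E_eq: "ln T - ln 2 - real (Suc n) * ln a = E (L N)"
      unfolding E_def lnT using L_eq by linarith
    have "ln (2 * a ^ Suc n) = ln 2 + real (Suc n) * ln a"
      using a by (subst ln_mult_pos) (simp_all add: ln_realpow del: power_Suc)
    then have "ln (2 * a ^ Suc n) < ln T" using E_eq E0 by linarith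
    then have T: "T \<ge> 2 * a ^ Suc n" using T0 a by (subst (asm) ln_less_cancel_iff) auto
    have "real N < 4/2 * real N * (3/4)" using elim by simp
    also have "\<dots> \<le> (real n + 3) / 2 * real N * (E (L N) / L N) ^ n"
      using n Ep by (intro mult_mono) auto
    also have "\<dots> = T / 2 * E (L N) ^ n / fact n"
      by (simp add: T_def power_divide mult_ac)
    also have "\<dots> \<le> real (card (hyp_cross a A T))"
      unfolding E_eq[symmetric] by (rule card_hyp_cross_ge[OF a A T])
    finally show ?case using L by (simp add: T_def)
  qed
  then show ?thesis by (simp add: L_def Let_def)
qed

theorem theorem6p9:
  fixes a :: real and s :: nat
  assumes a: "a > 1/2" and s: "s = CARD('s::finite)" and s2: "s \<ge> 2"
  shows "\<exists>Nstar::nat. \<forall>r>0. \<forall>\<alpha>>-1. \<forall>\<beta>>-1. a = (\<alpha> + \<beta> + 1) / 2 \<longrightarrow>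
    (\<forall>N\<ge>Nstar.
      ereal (1/2 * (1 / (real N * fact (s - 1) * (real s + 2))
                      * ln (real N * fact (s - 1) / a ^ s) ^ (s - 1)) powr r)
        \<le> kolmogorov_width N (K_ball r a \<alpha> \<beta> :: (real ^ 's \<Rightarrow> real) set) (L2 \<alpha> \<beta>) (L2_norm \<alpha> \<beta>)
      \<and> kolmogorov_width N (K_ball r a \<alpha> \<beta> :: (real ^ 's \<Rightarrow> real) set) (L2 \<alpha> \<beta>) (L2_norm \<alpha> \<beta>)
        \<le> ereal (2 powr r * (1 / (real N * fact (s - 1))
                      * ln (real N * fact (s - 1) / (a - 1/2) ^ s) ^ (s - 1)) powr r))"
proof -
  define n where "n = s - 1"
  have n: "n \<ge> 1" "s = Suc n" using s2 by (auto simp: n_def)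
  have card: "finite (UNIV :: 's set)" "card (UNIV :: 's set) = Suc n" using s n by auto
  have a0: "a > 0" using a by simp
  define Lu where "Lu N = ln (real N * fact n / (a - 1/2) ^ Suc n)" for N
  define Ll where "Ll N = ln (real N * fact n / a ^ Suc n)" for N
  \<comment> \<open>Both counting statements involve only \<open>a\<close> and the dimension, so one
    threshold serves all \<open>r\<close>, \<open>\<alpha>\<close> and
    \<open>\<beta>\<close>.\<close>
  have "\<forall>\<^sub>F N in sequentially. N > 0 \<and>
      Lu N > 0 \<and> card (hyp_cross a (UNIV :: 's set) (real N * fact n / (2 * Lu N ^ n))) \<le> N \<and>
      Ll N > 0 \<and> N < card (hyp_cross a (UNIV :: 's set) (real N * fact n * (real n + 3) / Ll N ^ n))"
    using eventually_hyp_cross_le[OF a n(1) card] eventually_hyp_cross_gt[OF a0 n(1) card] eventually_gt_at_top[of 0]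
    unfolding Let_def Lu_def[symmetric] Ll_def[symmetric] by eventually_elim blast
  then obtain Nstar where Nstar: "\<And>N. N \<ge> Nstar \<Longrightarrow> N > 0 \<and>
      Lu N > 0 \<and> card (hyp_cross a (UNIV :: 's set) (real N * fact n / (2 * Lu N ^ n))) \<le> N \<and>
      Ll N > 0 \<and> N < card (hyp_cross a (UNIV :: 's set) (real N * fact n * (real n + 3) / Ll N ^ n))"
    unfolding eventually_sequentially by blast
  show ?thesis
  proof (intro exI[of _ Nstar] allI impI conjI)
    fix r \<alpha> \<beta> :: real and N
    assume r: "r > 0" and ab: "\<alpha> > -1" "\<beta> > -1" and "N \<ge> Nstar"
    from Nstar[OF this(4)] have N: "N > 0"
      and Lu: "Lu N > 0" "card (hyp_cross a (UNIV :: 's set) (real N * fact n / (2 * Lu N ^ n))) \<le> N"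
      and Ll: "Ll N > 0" "N < card (hyp_cross a (UNIV :: 's set) (real N * fact n * (real n + 3) / Ll N ^ n))"
      by auto
    define Tu where "Tu = real N * fact n / (2 * Lu N ^ n)"
    define Tl where "Tl = real N * fact n * (real n + 3) / Ll N ^ n"
    have T: "Tu > 0" "Tl > 0" using N Lu(1) Ll(1) by (auto simp: Tu_def Tl_def)
    have inv: "x powr - r = (1 / x) powr r" if "x > 0" for x :: real
      using that by (simp add: powr_minus powr_divide divide_inverse inverse_powr)
    have "1 / 2 * (1 / (real N * fact n * (real n + 3)) * Ll N ^ n) powr r = 1 / 2 * Tl powr - r"
      unfolding inv[OF T(2)] by (simp add: Tl_def)
    also have "\<dots> \<le> Tl powr - r" by simp
    finally have "ereal (1 / 2 * (1 / (real N * fact n * (real n + 3)) * Ll N ^ n) powr r) \<le> ereal (Tl powr - r)"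
      by simp
    also have "\<dots> \<le> kolmogorov_width N (K_ball r a \<alpha> \<beta> :: (real ^ 's \<Rightarrow> real) set) (L2 \<alpha> \<beta>) (L2_norm \<alpha> \<beta>)"
      by (rule kolmogorov_width_K_ball_ge[OF ab a0 r T(2)]) (use Ll(2) in \<open>simp add: card_lam_le Tl_def\<close>)
    finally show "ereal (1/2 * (1 / (real N * fact (s - 1) * (real s + 2))
                      * ln (real N * fact (s - 1) / a ^ s) ^ (s - 1)) powr r)
        \<le> kolmogorov_width N (K_ball r a \<alpha> \<beta> :: (real ^ 's \<Rightarrow> real) set) (L2 \<alpha> \<beta>) (L2_norm \<alpha> \<beta>)"
      by (simp add: n(2) Ll_def add_ac)
    have "kolmogorov_width N (K_ball r a \<alpha> \<beta> :: (real ^ 's \<Rightarrow> real) set) (L2 \<alpha> \<beta>) (L2_norm \<alpha> \<beta>) \<le> ereal (Tu powr - r)"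
      by (rule kolmogorov_width_K_ball_le[OF ab a0 r T(1)]) (use Lu(2) in \<open>simp add: card_lam_le Tu_def\<close>)
    \<comment> \<open>The 2 in the denominator of \<open>Tu\<close> becomes the factor
      \<open>2 powr r\<close> of the claim.\<close>
    also have "Tu powr - r = (2 * (1 / (real N * fact n) * Lu N ^ n)) powr r"
      unfolding inv[OF T(1)] by (simp add: Tu_def)
    also have "\<dots> = 2 powr r * (1 / (real N * fact n) * Lu N ^ n) powr r"
      by (rule powr_mult)
    finally show "kolmogorov_width N (K_ball r a \<alpha> \<beta> :: (real ^ 's \<Rightarrow> real) set) (L2 \<alpha> \<beta>) (L2_norm \<alpha> \<beta>)
        \<le> ereal (2 powr r * (1 / (real N * fact (s - 1))
                      * ln (real N * fact (s - 1) / (a - 1/2) ^ s) ^ (s - 1)) powr r)"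
      by (simp add: n(2) Lu_def)
  qed
qed

end
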